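(* For every positive integer $m$, the coordinator polynomial of $\mathbb{Z}[\zeta_m]$ satisfies \[ h_m(x) = \left(h_{\sqrt m}(x)\right)^{m/\sqrt m}, \] where $\sqrt m$ denotes the squarefree part of $m$, i.e. the product of the distinct primes dividing $m$.
   Context: Let $\zeta_m = e^{2\pi i/m}$ and let $M$ be the set of all $m$-th roots of unity, which generates the lattice $\mathbb{Z}[\zeta_m]\cong\mathbb{Z}^{\phi(m)}$ as a monoid ($\phi$ is Euler's totient function). The word length of $z\in\mathbb{Z}[\zeta_m]$ is the minimal $n\ge 0$ such that $z$ is a sum of $n$ (not necessarily distinct) elements of $M$. Let $S(n)$ be the number of elements of $\mathbb{Z}[\zeta_m]$ of word length exactly $n$ (the coordination sequence). It is known that the growth series $\sum_{n\ge 0}S(n)x^n$ equals $h_m(x)/(1-x)^{\phi(m)}$ for a polynomial $h_m(x)$; this $h_m(x)$ is called the coordinator polynomial of $\mathbb{Z}[\zeta_m]$. *)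

theory Defs
  imports
    Complex_Main
    "HOL-Library.Extended_Nat"
    "HOL-Computational_Algebra.Computational_Algebra"
    "HOL-Number_Theory.Number_Theory"
begin

definition zeta :: "nat \<Rightarrow> complex" where
  "zeta m = exp (2 * of_real pi * \<i> / of_nat m)"

definition unity_roots :: "nat \<Rightarrow> complex set" where
  "unity_roots m = {w. w ^ m = 1}"

text \<open>The ring of integer polynomial expressions in \<open>zeta m\<close>.\<close>

definition cyclotomic_lattice :: "nat \<Rightarrow> complex set" where
  "cyclotomic_lattice m = range (\<lambda>p :: int poly. poly (map_poly of_int p) (zeta m))"

text \<open>
  The word length is \<open>\<infinity>\<close> for elements that are not sums of roots of unity. This happens only
  for the negative integers when \<open>m = 1\<close>: there the single root of unity 1 generates the
  integers as a group, but not as a monoid.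
\<close>

definition word_length :: "nat \<Rightarrow> complex \<Rightarrow> enat" where
  "word_length m z =
     Inf {enat n |n. \<exists>ws. length ws = n \<and> set ws \<subseteq> unity_roots m \<and> sum_list ws = z}"

definition coordination_sequence :: "nat \<Rightarrow> nat \<Rightarrow> nat" where
  "coordination_sequence m n = card {z \<in> cyclotomic_lattice m. word_length m z = enat n}"

definition growth_series :: "nat \<Rightarrow> rat fps" where
  "growth_series m = Abs_fps (\<lambda>n. of_nat (coordination_sequence m n))"

definition is_coordinator_poly :: "nat \<Rightarrow> rat poly \<Rightarrow> bool" where
  "is_coordinator_poly m h \<longleftrightarrow>
     growth_series m = fps_of_poly h / (1 - fps_X) ^ totient m"

lemma is_coordinator_poly_unique:
  assumes "is_coordinator_poly m h" "is_coordinator_poly m h'"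
  shows "h = h'"
proof -
  have "fps_nth ((1 - fps_X :: rat fps) ^ totient m) 0 \<noteq> 0"
    by (simp add: fps_nth_power_0)
  then have "is_unit ((1 - fps_X :: rat fps) ^ totient m)"
    by simp
  moreover have "fps_of_poly h / (1 - fps_X) ^ totient m
      = fps_of_poly h' / (1 - fps_X) ^ totient m"
    using assms by (simp add: is_coordinator_poly_def)
  ultimately have "fps_of_poly h = fps_of_poly h'"
    by (metis dvd_div_mult_self unit_imp_dvd)
  then show ?thesis
    by (simp add: fps_of_poly_eq_iff)
qed

text \<open>
  For every positive \<open>m\<close> such a polynomial exists, by a known theorem that is not proved here.
\<close>

definition coordinator_poly :: "nat \<Rightarrow> rat poly" where
  "coordinator_poly m = (THE h. is_coordinator_poly m h)"

text \<open>
  The product of the distinct primes dividing \<open>m\<close>. This is not the library's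
  \<^const>\<open>squarefree_part\<close>, which is the squarefree cofactor of a square.
\<close>

definition nat_radical :: "nat \<Rightarrow> nat" where
  "nat_radical m = \<Prod>(prime_factors m)"

end

theory Submission
  imports Defs "HOL-Real_Asymp.Real_Asymp"
begin

text \<open>
  Let \<open>r\<close> be the radical of \<open>m\<close> and \<open>q = m / r\<close>. Every prime divisor of \<open>q\<close> divides \<open>r\<close>, so the
  powers \<open>\<zeta>\<^sub>m^j\<close> with \<open>j < q\<close> are linearly independent over \<open>\<int>[\<zeta>\<^sub>r]\<close>, and the \<open>m\<close>-th roots of
  unity are the union of the translates \<open>\<zeta>\<^sub>m^j M\<^sub>r\<close>. Word length is therefore additive over a direct
  sum of \<open>q\<close> copies of \<open>\<int>[\<zeta>\<^sub>r]\<close>, and the growth series of \<open>\<int>[\<zeta>\<^sub>m]\<close> is the \<open>q\<close>-th power of that of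
  \<open>\<int>[\<zeta>\<^sub>r]\<close>, as is the denominator because \<open>\<phi>(m) = q \<phi>(r)\<close>.

  The definite description in \<open>coordinator_poly\<close> makes the existence of \<open>h\<^sub>r\<close> part of the claim. As in
  Khovanskii's theorem on sumsets, the growth series counts, by degree, the points of a down-closed
  set of exponent vectors, so it is a polynomial over a power of \<open>1 - x\<close>. Balls of radius \<open>n\<close> have
  \<open>O(n^\<phi>(r))\<close> elements, which limits the order of the pole at 1 to \<open>\<phi>(r)\<close>.
\<close>

hide_const (open) Module.smult UnivPoly.monom UnivPoly.coeff UnivPoly.deg

section \<open>Integer polynomials\<close>

definition int_poly_eval :: "int poly \<Rightarrow> complex \<Rightarrow> complex" where
  "int_poly_eval p z = poly (map_poly of_int p) z"

lemma int_poly_eval_0 [simp]: "int_poly_eval 0 z = 0"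
  by (simp add: int_poly_eval_def)

lemma int_poly_eval_pCons [simp]:
  "int_poly_eval (pCons a p) z = of_int a + z * int_poly_eval p z"
  by (simp add: int_poly_eval_def map_poly_pCons)

lemma int_poly_eval_1 [simp]: "int_poly_eval 1 z = 1"
  by (simp add: one_pCons)

lemma int_poly_eval_add [simp]:
  "int_poly_eval (p + q) z = int_poly_eval p z + int_poly_eval q z"
proof -
  have "map_poly of_int (p + q) = (map_poly of_int p + map_poly of_int q :: complex poly)"
    by (intro poly_eqI) (simp add: coeff_map_poly)
  then show ?thesis
    by (simp add: int_poly_eval_def)
qed

lemma int_poly_eval_smult [simp]:
  "int_poly_eval (smult c p) z = of_int c * int_poly_eval p z"
  by (induction p) (auto simp: algebra_simps)

lemma int_poly_eval_minus [simp]: "int_poly_eval (- p) z = - int_poly_eval p z"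
  by (induction p) (auto simp: algebra_simps)

lemma int_poly_eval_diff [simp]:
  "int_poly_eval (p - q) z = int_poly_eval p z - int_poly_eval q z"
  using int_poly_eval_add[of p "- q" z] by simp

lemma int_poly_eval_mult [simp]:
  "int_poly_eval (p * q) z = int_poly_eval p z * int_poly_eval q z"
  by (induction p) (auto simp: algebra_simps)

lemma int_poly_eval_power [simp]: "int_poly_eval (p ^ n) z = int_poly_eval p z ^ n"
  by (induction n) auto

lemma int_poly_eval_sum [simp]:
  "int_poly_eval (\<Sum>i\<in>I. p i) z = (\<Sum>i\<in>I. int_poly_eval (p i) z)"
  by (induction I rule: infinite_finite_induct) auto

lemma int_poly_eval_monom [simp]: "int_poly_eval (monom a n) z = of_int a * z ^ n"
  by (simp add: int_poly_eval_def map_poly_monom poly_monom)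

lemma int_poly_eval_pcompose [simp]:
  "int_poly_eval (pcompose p q) z = int_poly_eval p (int_poly_eval q z)"
  by (induction p) (auto simp: pcompose_pCons)

lemma int_poly_eval_eq_sum:
  assumes "degree p < n"
  shows "int_poly_eval p z = (\<Sum>i<n. of_int (coeff p i) * z ^ i)"
proof -
  have "p = (\<Sum>i<n. monom (coeff p i) i)"
    using assms by (intro poly_eqI) (auto simp: coeff_sum coeff_eq_0)
  then have "int_poly_eval p z = int_poly_eval (\<Sum>i<n. monom (coeff p i) i) z"
    by simp
  then show ?thesis
    by simp
qed

text \<open>Gauss's lemma makes the annihilator of an algebraic integer in \<open>\<int>[x]\<close> a principal ideal.\<close>

lemma int_minimal_poly_exists:
  assumes "lead_coeff f = 1" "int_poly_eval f z = 0"
  obtains g where "lead_coeff g = 1" "\<And>p. int_poly_eval p z = 0 \<longleftrightarrow> g dvd p"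
proof -
  define P where "P = (\<lambda>h. h \<noteq> 0 \<and> int_poly_eval h z = 0)"
  have "P f"
    using assms by (auto simp: P_def)
  then obtain h where h: "P h" and hmin: "\<And>p. P p \<Longrightarrow> degree h \<le> degree p"
    using arg_min_natI[of P f degree] arg_min_nat_le[of P _ degree] by metis
  define g where "g = primitive_part h"
  have "h = smult (content h) g" "content h \<noteq> 0"
    using h by (simp_all add: g_def P_def)
  then have "P g"
    using h by (metis P_def int_poly_eval_smult mult_eq_0_iff of_int_eq_0_iff smult_eq_0_iff)
  have deg: "degree g = degree h" and cont: "content g = 1"
    using h by (simp_all add: g_def P_def)
  have dvd: "g dvd p" if p: "int_poly_eval p z = 0" for p
  proof -
    define r where "r = pseudo_mod p g"
    obtain c q where cq: "c \<noteq> 0" "smult c p = g * q + r"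
      using pseudo_mod(1)[of g p] \<open>P g\<close> unfolding P_def r_def by auto
    have "int_poly_eval r z = int_poly_eval (smult c p) z - int_poly_eval (g * q) z"
      unfolding cq(2) by (simp only: int_poly_eval_add) simp
    also have "\<dots> = 0"
      using p \<open>P g\<close> by (simp add: P_def)
    finally have "r = 0"
      using pseudo_mod(2)[of g p] hmin[of r] \<open>P g\<close> deg unfolding P_def r_def by fastforce
    with cq have eq: "smult c p = g * q"
      by simp
    \<comment> \<open>The content is multiplicative and \<open>g\<close> is primitive, so the
      constant \<open>c\<close> brought in by pseudo-division divides \<open>q\<close> and
      cancels.\<close>
    have "c dvd content (g * q)"
      unfolding eq[symmetric] by simp
    then have "c dvd content q"
      by (simp add: content_mult cont)
    then obtain q' where "q = [:c:] * q'"
      unfolding const_poly_dvd_iff_dvd_content[symmetric] by (rule dvdE)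
    with eq have "smult c p = smult c (g * q')"
      by simp
    then have "smult c (p - g * q') = 0"
      by (simp add: smult_diff_right)
    with cq(1) have "p = g * q'"
      by simp
    then show ?thesis
      by simp
  qed
  \<comment> \<open>\<open>g\<close> divides the monic \<open>f\<close>, so its leading coefficient
    is 1 or -1; \<open>g'\<close> corrects the sign.\<close>
  have "lead_coeff g dvd lead_coeff f"
    using dvd[OF assms(2)] by (auto elim!: dvdE simp: lead_coeff_mult)
  then have unit: "\<bar>lead_coeff g\<bar> = 1"
    using assms(1) by simp
  define g' where "g' = smult (lead_coeff g) g"
  have unit2: "lead_coeff g * lead_coeff g = 1"
    using unit by (metis abs_mult_self_eq mult_1)
  have "lead_coeff g' = 1"
    using unit2 by (auto simp: g'_def)
  moreover have "int_poly_eval p z = 0 \<longleftrightarrow> g' dvd p" for p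
  proof
    assume "int_poly_eval p z = 0"
    then obtain q where "p = g * q"
      using dvd by (auto elim!: dvdE)
    then have "p = g' * smult (lead_coeff g) q"
      using unit2 by (simp add: g'_def)
    then show "g' dvd p"
      by (rule dvdI)
  next
    assume "g' dvd p"
    then show "int_poly_eval p z = 0"
      using \<open>P g\<close> by (auto elim!: dvdE simp: g'_def P_def)
  qed
  ultimately show ?thesis
    using that by blast
qed

text \<open>Pseudo-division scales the dividend by a power of the leading coefficient, here 1.
  Positive degree of \<open>g\<close> lets the strict bound cover a zero remainder as well.\<close>

lemma monic_int_poly_division:
  fixes p g :: "int poly"
  assumes "lead_coeff g = 1" "degree g > 0"
  obtains q r where "p = g * q + r" "degree r < degree g"
proof -
  obtain q r where qr: "pseudo_divmod p g = (q, r)"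
    by force
  have "g \<noteq> 0"
    using assms by auto
  from pseudo_divmod[OF this qr] assms have "p = g * q + r" "degree r < degree g"
    by auto
  then show ?thesis
    by (rule that)
qed

section \<open>Frobenius congruences modulo a prime\<close>

lemma prime_dvd_add_power:
  fixes a b :: "'a :: comm_ring_1"
  assumes "prime p"
  shows "of_nat p dvd (a + b) ^ p - (a ^ p + b ^ p)"
proof -
  have "p > 0"
    using assms by (simp add: prime_gt_0_nat)
  have "(a + b) ^ p = (\<Sum>k\<le>p. of_nat (p choose k) * a ^ k * b ^ (p - k))"
    by (rule binomial_ring)
  also have "{..p} = insert 0 (insert p {0<..<p})"
    using \<open>p > 0\<close> by auto
  also have "(\<Sum>k\<in>\<dots>. of_nat (p choose k) * a ^ k * b ^ (p - k)) =
      a ^ p + b ^ p + (\<Sum>k\<in>{0<..<p}. of_nat (p choose k) * a ^ k * b ^ (p - k))"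
    using \<open>p > 0\<close> by (subst sum.insert; simp)+
  finally have "(a + b) ^ p - (a ^ p + b ^ p) =
      (\<Sum>k\<in>{0<..<p}. of_nat (p choose k) * a ^ k * b ^ (p - k))"
    by (simp add: algebra_simps)
  also have "of_nat p dvd \<dots>"
  proof (intro dvd_sum dvd_mult2)
    fix k assume "k \<in> {0<..<p}"
    then have "p dvd p choose k"
      using assms by (intro dvd_choose_prime) auto
    then show "of_nat p dvd (of_nat (p choose k) :: 'a)"
      by (auto elim!: dvdE)
  qed
  finally show ?thesis .
qed

text \<open>Fermat's little theorem: the congruence for \<open>(n + 1)^p\<close> gives it for
  naturals, and shifting by a multiple of \<open>p\<close> reduces integers to naturals.\<close>

lemma prime_dvd_power_self_diff:
  fixes a :: int
  assumes "prime p"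
  shows "int p dvd a ^ p - a"
proof -
  have nat: "int p dvd int n ^ p - int n" for n
  proof (induction n)
    case (Suc n)
    have "int p dvd ((int n + 1) ^ p - (int n ^ p + 1 ^ p)) + (int n ^ p - int n)"
      using prime_dvd_add_power[OF assms, of "int n" 1] Suc by (intro dvd_add) auto
    then show ?case
      by (simp add: algebra_simps)
  qed (use prime_gt_0_nat[OF assms] in \<open>simp add: zero_power\<close>)
  have "a + int p * \<bar>a\<bar> \<ge> 0"
    using prime_ge_1_nat[OF assms] by (smt (verit) mult_le_cancel_right1 of_nat_1 of_nat_mono)
  then obtain n where n: "a + int p * \<bar>a\<bar> = int n"
    by (metis zero_le_imp_eq_int)
  have "[a = int n] (mod int p)"
    unfolding n[symmetric] by (simp add: cong_iff_dvd_diff)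
  then have "[a ^ p - a = int n ^ p - int n] (mod int p)"
    by (intro cong_diff cong_pow)
  then show ?thesis
    using nat[of n] by (simp add: cong_dvd_iff)
qed

text \<open>Modulo \<open>p\<close>, raising to the \<open>p\<close>-th power is additive and fixes
  constants, hence it only replaces \<open>x\<close> by \<open>x^p\<close>.\<close>

lemma prime_dvd_pcompose_power_diff:
  fixes f :: "int poly"
  assumes "prime p"
  shows "of_nat p dvd pcompose f (monom 1 p) - f ^ p"
proof (induction f)
  case 0
  then show ?case
    using prime_gt_0_nat[OF assms] by (simp add: zero_power)
next
  case (pCons a f)
  let ?x = "monom 1 1 :: int poly"
  have "pCons a f = [:a:] + ?x * f"
    by (simp add: monom_altdef)
  moreover have "pcompose (pCons a f) (monom 1 p) = [:a:] + ?x ^ p * pcompose f (monom 1 p)"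
    by (simp add: pcompose_pCons monom_power)
  ultimately have "pcompose (pCons a f) (monom 1 p) - pCons a f ^ p =
      - ([:a:] ^ p - [:a:]) + ?x ^ p * (pcompose f (monom 1 p) - f ^ p)
      - (([:a:] + ?x * f) ^ p - ([:a:] ^ p + (?x * f) ^ p))"
    by (simp add: algebra_simps power_mult_distrib)
  moreover have "of_nat p dvd [:a:] ^ p - [:a:]"
  proof -
    obtain c where "a ^ p - a = int p * c"
      using prime_dvd_power_self_diff[OF assms] by (rule dvdE)
    then have "[:a:] ^ p - [:a:] = of_nat p * [:c:]"
      by (simp add: poly_const_pow of_nat_poly)
    then show ?thesis
      by (rule dvdI)
  qed
  moreover note pCons prime_dvd_add_power[OF assms, of "[:a:]" "?x * f"]
  ultimately show ?case
    by (metis dvd_add dvd_diff dvd_minus_iff dvd_mult)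
qed

section \<open>Conjugates of roots of unity\<close>

lemma zeta_eq_cis: "zeta m = cis (2 * pi / real m)"
  by (simp add: zeta_def cis_conv_exp mult_ac)

lemma zeta_power_eq_cis: "zeta m ^ k = cis (2 * pi * real k / real m)"
  by (simp add: zeta_eq_cis DeMoivre mult_ac)

lemma zeta_nonzero [simp]: "zeta m \<noteq> 0"
  by (simp add: zeta_def)

lemma bij_betw_zeta_power:
  assumes "m > 0"
  shows "bij_betw (\<lambda>k. zeta m ^ k) {..<m} (unity_roots m)"
  using bij_betw_roots_unity[OF assms] by (simp add: unity_roots_def zeta_power_eq_cis)

lemma unity_roots_eq_image:
  assumes "m > 0"
  shows "unity_roots m = (\<lambda>k. zeta m ^ k) ` {..<m}"
  using bij_betw_zeta_power[OF assms] by (simp add: bij_betw_def)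

lemma finite_unity_roots: "m > 0 \<Longrightarrow> finite (unity_roots m)"
  by (simp add: unity_roots_eq_image)

lemma zeta_power_self [simp]: "zeta m ^ m = 1"
  by (cases "m = 0") (simp_all add: zeta_power_eq_cis)

lemma zeta_power_in_unity_roots: "zeta m ^ k \<in> unity_roots m"
proof -
  have "(zeta m ^ k) ^ m = (zeta m ^ m) ^ k"
    by (metis mult.commute power_mult)
  then show ?thesis
    by (simp add: unity_roots_def)
qed

lemma zeta_power_mod: "zeta m ^ (k mod m) = zeta m ^ k"
proof -
  have "zeta m ^ k = zeta m ^ (m * (k div m) + k mod m)"
    by simp
  then show ?thesis
    by (simp only: power_add power_mult) simp
qed

lemma zeta_power_eq_1_iff:
  assumes "m > 0"
  shows "zeta m ^ k = 1 \<longleftrightarrow> m dvd k"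
proof
  assume "zeta m ^ k = 1"
  then have "zeta m ^ (k mod m) = zeta m ^ 0"
    by (simp add: zeta_power_mod)
  then have "k mod m = 0"
    using bij_betw_zeta_power[OF assms] assms
    unfolding bij_betw_def by (metis inj_onD lessThan_iff mod_less_divisor)
  then show "m dvd k"
    by auto
next
  assume "m dvd k"
  then show "zeta m ^ k = 1"
    by (auto elim!: dvdE simp: power_mult)
qed

lemma zeta_mult_power: "q > 0 \<Longrightarrow> zeta (q * r) ^ q = zeta r"
  by (simp add: zeta_power_eq_cis) (simp add: zeta_eq_cis)

text \<open>\<open>z\<close> is a root of the monic \<open>x^m - 1\<close>. It is arbitrary because
  the minimal polynomials of \<open>zeta m\<close> and of its powers are compared later.\<close>

lemma unity_root_minimal_poly_exists:
  assumes "m > 0" "z ^ m = 1"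
  obtains g where "lead_coeff g = 1" "degree g > 0"
    "\<And>p. int_poly_eval p z = 0 \<longleftrightarrow> g dvd p"
proof -
  have "lead_coeff (monom 1 m - 1 :: int poly) = 1"
  proof -
    have "degree (monom 1 m - 1 :: int poly) = m"
      using assms by (subst diff_conv_add_uminus, subst degree_add_eq_left) (auto simp: degree_monom_eq)
    then show ?thesis
      using assms by simp
  qed
  moreover have "int_poly_eval (monom 1 m - 1) z = 0"
    using assms(2) by simp
  ultimately obtain g where g: "lead_coeff g = 1"
      "\<And>p. int_poly_eval p z = 0 \<longleftrightarrow> g dvd p"
    by (rule int_minimal_poly_exists) auto
  have "degree g > 0"
  proof (rule ccontr)
    assume "\<not> degree g > 0"
    then obtain a where "g = [:a:]"
      by (metis degree_eq_zeroE neq0_conv)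
    then have "g = 1"
      using g(1) by (simp add: one_pCons)
    then show False
      using g(2)[of 1] by simp
  qed
  with g show ?thesis
    using that by blast
qed

text \<open>
  Landau's argument: the remainder of \<open>f(x^p)\<close> modulo the minimal polynomial is divisible by \<open>p\<close>,
  since \<open>f(x^p) \<equiv> f(x)^p\<close> modulo \<open>p\<close>, while it is one of only finitely many remainders.
\<close>

lemma int_poly_eval_zeta_prime_power_eq_0:
  assumes "m > 0"
  obtains A where "\<And>n p. prime p \<Longrightarrow> p > A \<Longrightarrow> int_poly_eval f (zeta m ^ n) = 0 \<Longrightarrow>
    int_poly_eval f (zeta m ^ (n * p)) = 0"
proof -
  obtain g where g: "lead_coeff g = 1" "degree g > 0"
      "\<And>p. int_poly_eval p (zeta m) = 0 \<longleftrightarrow> g dvd p"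
    using unity_root_minimal_poly_exists[OF assms(1) zeta_power_self] by metis
  have "\<exists>r. degree r < degree g \<and> int_poly_eval r (zeta m) = int_poly_eval f (zeta m ^ j)" for j
  proof -
    obtain q r where qr: "pcompose f (monom 1 j) = g * q + r" "degree r < degree g"
      using monic_int_poly_division[OF g(1,2)] by blast
    have "int_poly_eval f (zeta m ^ j) = int_poly_eval (pcompose f (monom 1 j)) (zeta m)"
      by simp
    also have "\<dots> = int_poly_eval r (zeta m)"
      using g(3)[of g] unfolding qr by simp
    finally show ?thesis
      using qr by metis
  qed
  then obtain r where r: "\<And>j. degree (r j) < degree g"
      "\<And>j. int_poly_eval (r j) (zeta m) = int_poly_eval f (zeta m ^ j)"
    by metis
  \<comment> \<open>The absolute coefficients of all remainders that can occur: exponents of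
    \<open>zeta m\<close> matter only modulo \<open>m\<close>.\<close>
  define S where "S = (\<lambda>(j, i). nat \<bar>coeff (r j) i\<bar>) ` ({..<m} \<times> {..<degree g})"
  have "int_poly_eval f (zeta m ^ (n * p)) = 0"
    if p: "prime p" "p > Max S" and n: "int_poly_eval f (zeta m ^ n) = 0" for n p
  proof -
    define j where "j = n * p mod m"
    define f' where "f' = pcompose f (monom 1 n)"
    have "j < m"
      using assms by (simp add: j_def)
    obtain h where h: "pcompose f' (monom 1 p) - f' ^ p = of_nat p * h"
      using prime_dvd_pcompose_power_diff[OF p(1)] by (rule dvdE)
    obtain q s where qs: "h = g * q + s" "degree s < degree g"
      using monic_int_poly_division[OF g(1,2)] by blast
    have "int_poly_eval f (zeta m ^ (n * p)) =
        int_poly_eval (pcompose f' (monom 1 p) - f' ^ p) (zeta m)"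
      using n prime_gt_0_nat[OF p(1)]
      by (simp add: zero_power f'_def flip: power_mult) (simp add: mult.commute)
    also have "\<dots> = int_poly_eval (of_nat p * s) (zeta m)"
      using g(3)[of g] unfolding h qs by simp
    finally have "int_poly_eval (r j - of_nat p * s) (zeta m) = 0"
      using r(2)[of j] by (simp add: j_def zeta_power_mod)
    then have "g dvd r j - of_nat p * s"
      using g(3) by blast
    moreover have "degree (r j - of_nat p * s) < degree g"
    proof (rule degree_diff_less)
      show "degree (of_nat p * s) < degree g"
        using qs(2) by (simp add: of_nat_poly)
    qed (rule r)
    \<comment> \<open>A multiple of \<open>g\<close> of smaller degree is zero. So \<open>p\<close>
      divides every coefficient of \<open>r j\<close>, and these are all below \<open>p\<close> in
      absolute value.\<close>
    ultimately have eq: "r j = of_nat p * s"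
      using dvd_imp_degree_le[of g "r j - of_nat p * s"] by fastforce
    have "coeff (r j) i = 0" for i
    proof (cases "i < degree g")
      case True
      have "nat \<bar>coeff (r j) i\<bar> \<le> Max S"
        using True \<open>j < m\<close> by (intro Max_ge) (auto simp: S_def)
      then have "\<bar>coeff (r j) i\<bar> < int p"
        using p(2) by linarith
      moreover have "int p dvd coeff (r j) i"
        by (simp add: eq of_nat_poly)
      ultimately show ?thesis
        using zdvd_imp_le[of "int p" "\<bar>coeff (r j) i\<bar>"] by fastforce
    next
      case False
      then show ?thesis
        using r(1)[of j] by (intro coeff_eq_0) auto
    qed
    then have "r j = 0"
      by (intro poly_eqI) simp
    then show ?thesis
      using r(2)[of j] by (simp add: j_def zeta_power_mod)
  qed
  then show ?thesis
    by (rule that)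
qed

text \<open>Galois conjugacy of the primitive roots. The exponent \<open>k\<close> is replaced by
  one congruent modulo \<open>m\<close> whose prime factors all exceed \<open>A\<close>, and these
  primes are applied one after the other.\<close>

theorem int_poly_eval_zeta_coprime_power_eq_0:
  assumes "m > 0" "coprime k m" "int_poly_eval f (zeta m) = 0"
  shows "int_poly_eval f (zeta m ^ k) = 0"
proof -
  obtain A where A: "\<And>n p. prime p \<Longrightarrow> p > A \<Longrightarrow> int_poly_eval f (zeta m ^ n) = 0 \<Longrightarrow>
      int_poly_eval f (zeta m ^ (n * p)) = 0"
    using int_poly_eval_zeta_prime_power_eq_0[OF assms(1)] by metis
  have rough: "int_poly_eval f (zeta m ^ n) = 0"
    if "n > 0" "\<And>p. prime p \<Longrightarrow> p dvd n \<Longrightarrow> p > A" for n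
    using that
  proof (induction n rule: prime_divisors_induct)
    case (factor p n)
    then have "int_poly_eval f (zeta m ^ (n * p)) = 0"
      by (intro A) auto
    then show ?case
      by (simp add: mult.commute)
  qed (use assms(3) in auto)
  define P where "P = {p. prime p \<and> p \<le> A \<and> \<not> p dvd k}"
  have "finite P"
    by (rule finite_subset[of _ "{..A}"]) (auto simp: P_def)
  \<comment> \<open>A prime up to \<open>A\<close> divides exactly one of \<open>k\<close> and
    \<open>m * \<Prod>P\<close>, so it does not divide the sum.\<close>
  define k' where "k' = k + m * \<Prod>P"
  have "p > A" if p: "prime p" "p dvd k'" for p
  proof (rule ccontr)
    assume "\<not> p > A"
    show False
    proof (cases "p dvd k")
      case True
      then have "p dvd m * \<Prod>P"
        using p(2) unfolding k'_def by (metis dvd_add_right_iff)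
      moreover have "\<not> p dvd m"
        using assms(2) True p(1) by (metis coprime_common_divisor not_prime_unit)
      ultimately obtain p' where "p' \<in> P" "p dvd p'"
        using p(1) \<open>finite P\<close> by (auto simp: prime_dvd_mult_iff prime_dvd_prod_iff)
      then show False
        using p(1) True using primes_dvd_imp_eq[of p p'] by (auto simp: P_def)
    next
      case False
      then have "p \<in> P"
        using p \<open>\<not> p > A\<close> by (auto simp: P_def)
      then have "p dvd m * \<Prod>P"
        using \<open>finite P\<close> by (intro dvd_mult dvd_prodI)
      then show False
        using p(2) False unfolding k'_def by (metis dvd_add_left_iff)
    qed
  qed
  moreover have "\<Prod>P > 0"
    by (rule prod_pos) (auto simp: P_def prime_gt_0_nat)
  then have "k' > 0"
    using assms(1) by (simp add: k'_def)
  ultimately have "int_poly_eval f (zeta m ^ k') = 0"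
    using rough by blast
  moreover have "zeta m ^ k' = zeta m ^ k"
    by (simp add: k'_def power_add power_mult)
  ultimately show ?thesis
    by simp
qed

section \<open>Degree of the minimal polynomial of \<open>zeta m\<close>\<close>

lemma degree_map_poly_of_int [simp]:
  "degree (map_poly of_int p :: 'a :: ring_char_0 poly) = degree p"
  by (rule degree_map_poly) simp

text \<open>\<open>x^m - 1\<close> has \<open>m\<close> distinct complex roots, of which the
  cofactor of \<open>g\<close> accounts for at most its degree. So \<open>g\<close> has at least
  \<open>degree g\<close> roots, and all of them turn out to be primitive.\<close>

lemma zeta_minimal_poly_degree_le:
  assumes "m > 0" "lead_coeff g = 1" and g: "\<And>p. int_poly_eval p (zeta m) = 0 \<longleftrightarrow> g dvd p"
  shows "degree g \<le> totient m"
proof -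
  define G where "G = (map_poly of_int g :: complex poly)"
  obtain u where u: "monom 1 m - 1 = g * u"
    using g[of "monom 1 m - 1"] by (auto elim!: dvdE)
  define U where "U = (map_poly of_int u :: complex poly)"
  have deg: "degree (monom 1 m - 1 :: int poly) = m"
    using assms(1)
    by (subst diff_conv_add_uminus, subst degree_add_eq_left) (auto simp: degree_monom_eq)
  have "g * u \<noteq> 0"
    using deg assms(1) u by force
  then have deg_gu: "degree g + degree u = m"
    using deg u by (simp add: degree_mult_eq)
  have "G \<noteq> 0" "U \<noteq> 0"
    using \<open>g * u \<noteq> 0\<close> by (auto simp: G_def U_def map_poly_eq_0_iff)
  have ev: "z ^ m - 1 = poly G z * poly U z" for z
  proof -
    have "z ^ m - 1 = int_poly_eval (monom 1 m - 1) z"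
      by simp
    also have "\<dots> = int_poly_eval g z * int_poly_eval u z"
      by (simp only: u int_poly_eval_mult)
    finally show ?thesis
      by (simp add: G_def U_def int_poly_eval_def)
  qed
  have roots: "{z. poly G z = 0} \<subseteq> (\<lambda>k. zeta m ^ k) ` totatives m"
  proof
    fix z assume z: "z \<in> {z. poly G z = 0}"
    then have "z ^ m = 1"
      using ev[of z] by simp
    then have "z \<in> (\<lambda>k. zeta m ^ k) ` {..<m}"
      using unity_roots_eq_image[OF assms(1)] by (auto simp: unity_roots_def)
    then obtain k where k: "z = zeta m ^ k" "k < m"
      by auto
    \<comment> \<open>An exponent with \<open>z ^ n = 1\<close>, smaller than \<open>m\<close>
      unless \<open>k\<close> is coprime to \<open>m\<close>.\<close>
    define n where "n = m div gcd k m"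
    have "z ^ n = 1"
    proof -
      have "m dvd k * n"
        unfolding n_def by (metis div_mult_swap dvd_triv_right gcd_dvd1 gcd_dvd2 dvd_div_mult mult.commute)
      then show ?thesis
        using zeta_power_eq_1_iff[OF assms(1)] by (simp add: k flip: power_mult)
    qed
    \<comment> \<open>Comparing degrees shows that \<open>g\<close> divides \<open>h\<close>, the
      minimal polynomial of \<open>z\<close>. Hence \<open>zeta m\<close> satisfies
      \<open>x^n = 1\<close> too, which forces \<open>n = m\<close>.\<close>
    obtain h where h: "lead_coeff h = 1" "degree h > 0"
      "\<And>p. int_poly_eval p z = 0 \<longleftrightarrow> h dvd p"
      using unity_root_minimal_poly_exists[OF assms(1) \<open>z ^ m = 1\<close>] by metis
    have "h dvd g"
      using z h(3)[of g] by (simp add: G_def int_poly_eval_def)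
    then obtain v where v: "g = h * v"
      by (rule dvdE)
    have "int_poly_eval h (zeta m) = 0 \<or> int_poly_eval v (zeta m) = 0"
      using g[of g] unfolding v by simp
    moreover have "int_poly_eval v (zeta m) \<noteq> 0"
    proof
      assume "int_poly_eval v (zeta m) = 0"
      then have "g dvd v"
        using g by simp
      moreover have "v \<noteq> 0"
        using v assms(2) by auto
      ultimately have "degree g \<le> degree v"
        by (rule dvd_imp_degree_le)
      then show False
        using h(2) \<open>v \<noteq> 0\<close> unfolding v by (subst (asm) degree_mult_eq) auto
    qed
    ultimately have "g dvd h"
      using g by simp
    moreover have "h dvd monom 1 n - 1"
      using h(3)[of "monom 1 n - 1"] \<open>z ^ n = 1\<close> by simp
    ultimately have "g dvd monom 1 n - 1"
      by (rule dvd_trans)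
    then have "zeta m ^ n = 1"
      using g[of "monom 1 n - 1"] by simp
    then have "m dvd n"
      using zeta_power_eq_1_iff[OF assms(1)] by simp
    moreover have m: "n * gcd k m = m"
      by (simp add: n_def)
    moreover from m assms(1) have "n > 0"
      by (metis gr0I mult_0 less_irrefl)
    ultimately have "gcd k m \<le> 1"
      by (metis dvd_imp_le mult_le_cancel1 mult.right_neutral)
    moreover have "gcd k m > 0"
      using assms(1) by simp
    ultimately have "coprime k m"
      by (metis coprime_iff_gcd_eq_1 le_antisym One_nat_def Suc_leI)
    show "z \<in> (\<lambda>k. zeta m ^ k) ` totatives m"
    \<comment> \<open>The exponent 0 is coprime to \<open>m\<close> only for \<open>m = 1\<close>,
      where the totative is 1.\<close>
    proof (cases "k = 0")
      case True
      with \<open>coprime k m\<close> have "m = 1"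
        by simp
      then show ?thesis
        using True k(1) zeta_power_self[of 1] by auto
    next
      case False
      then show ?thesis
        using k \<open>coprime k m\<close> by (auto simp: in_totatives_iff)
    qed
  qed
  have "m = card {z :: complex. z ^ m = 1}"
    using assms(1) by (simp add: card_roots_unity_eq)
  also have "{z :: complex. z ^ m = 1} = {z. poly G z = 0} \<union> {z. poly U z = 0}"
  proof -
    have "z ^ m = 1 \<longleftrightarrow> poly G z = 0 \<or> poly U z = 0" for z
      using ev[of z] by auto
    then show ?thesis
      by blast
  qed
  also have "card \<dots> \<le> card {z. poly G z = 0} + card {z. poly U z = 0}"
    by (rule card_Un_le)
  also have "card {z. poly U z = 0} \<le> degree u"
    using card_poly_roots_bound[OF \<open>U \<noteq> 0\<close>] by (simp add: U_def)
  finally have "degree g \<le> card {z. poly G z = 0}"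
    using deg_gu by simp
  also have "\<dots> \<le> card ((\<lambda>k. zeta m ^ k) ` totatives m)"
    using roots by (intro card_mono) auto
  also have "\<dots> \<le> totient m"
    unfolding totient_def by (intro card_image_le) auto
  finally show ?thesis .
qed

text \<open>
  The conjugations \<open>\<zeta> \<mapsto> \<zeta>^(1 + r t)\<close> fix \<open>\<zeta>^q\<close> and multiply \<open>\<zeta>\<close> by the \<open>q\<close>-th roots of unity. Hence
  the relation turns into a polynomial of degree less than \<open>q\<close> with \<open>q\<close> roots.
\<close>

lemma zeta_powers_independent:
  assumes "q > 0" "r > 0" "\<And>p. prime p \<Longrightarrow> p dvd q \<Longrightarrow> p dvd r"
    and sum: "(\<Sum>j<q. zeta (q * r) ^ j * int_poly_eval (P j) (zeta r)) = 0" and "j < q"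
  shows "int_poly_eval (P j) (zeta r) = 0"
proof -
  define m where "m = q * r"
  have "m > 0"
    using assms by (simp add: m_def)
  define F where "F = (\<Sum>j<q. monom 1 j * pcompose (P j) (monom 1 q))"
  have zq: "zeta m ^ q = zeta r"
    using assms(1) by (simp add: m_def zeta_mult_power)
  have zr: "zeta m ^ r = zeta q"
    using zeta_mult_power[OF assms(2), of q] by (simp only: m_def mult.commute)
  have F0: "int_poly_eval F (zeta m) = 0"
    using sum by (simp add: F_def zq) (simp add: m_def)
  \<comment> \<open>The variable of \<open>C\<close> stands for the \<open>q\<close>-th root of
    unity by which a conjugation multiplies \<open>zeta m\<close>.\<close>
  define C where "C = (\<Sum>j<q. monom (zeta m ^ j * int_poly_eval (P j) (zeta r)) j)"
  have root: "poly C (zeta q ^ t) = 0" for t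
  proof -
    define k where "k = 1 + r * t"
    have "coprime k m"
    proof (rule ccontr)
      assume "\<not> coprime k m"
      then obtain p where p: "prime p" "p dvd k" "p dvd m"
        by (metis coprime_iff_gcd_eq_1 gcd_dvd1 gcd_dvd2 dvd_trans prime_factor_nat)
      then have "p dvd r * t"
        using assms(3) by (auto simp: m_def prime_dvd_mult_iff)
      then have "p dvd 1"
        using p(2) unfolding k_def by (metis dvd_add_left_iff)
      then show False
        using p(1) by simp
    qed
    then have "int_poly_eval F (zeta m ^ k) = 0"
      using F0 \<open>m > 0\<close> by (rule int_poly_eval_zeta_coprime_power_eq_0[rotated])
    moreover have "zeta m ^ k = zeta m * zeta q ^ t"
      by (simp add: k_def power_add power_mult zr)
    moreover have "(zeta m * zeta q ^ t) ^ q = zeta r"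
    proof -
      have "(zeta q ^ t) ^ q = (zeta q ^ q) ^ t"
        by (metis mult.commute power_mult)
      then show ?thesis
        by (simp add: power_mult_distrib zq)
    qed
    ultimately have "0 = (\<Sum>j<q. (zeta m * zeta q ^ t) ^ j * int_poly_eval (P j) (zeta r))"
      by (simp add: F_def)
    also have "\<dots> = poly C (zeta q ^ t)"
      unfolding C_def poly_sum poly_monom
      by (intro sum.cong refl) (simp only: power_mult_distrib mult_ac)
    finally show ?thesis
      by simp
  qed
  have "C = 0"
  proof (rule ccontr)
    assume "C \<noteq> 0"
    have "q = card (unity_roots q)"
      using assms(1) by (simp add: unity_roots_def card_roots_unity_eq)
    also have "\<dots> \<le> card {z. poly C z = 0}"
      using root poly_roots_finite[OF \<open>C \<noteq> 0\<close>]
      by (intro card_mono) (auto simp: unity_roots_eq_image[OF assms(1)])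
    also have "\<dots> \<le> degree C"
      by (rule card_poly_roots_bound) fact
    also have "\<dots> < q"
      unfolding C_def using assms(1)
      by (intro degree_sum_less) (auto intro: le_less_trans[OF degree_monom_le])
    finally show False
      by simp
  qed
  then have "coeff C j = 0"
    by simp
  then show ?thesis
    using \<open>j < q\<close> by (simp add: C_def coeff_sum)
qed

section \<open>Word growth and direct sums\<close>

definition sumset :: "nat \<Rightarrow> 'a :: comm_monoid_add set \<Rightarrow> 'a set" where
  "sumset n A = {sum_list ws |ws. length ws = n \<and> set ws \<subseteq> A}"

text \<open>\<open>sumset n A\<close> admits only words of length exactly \<open>n\<close> and need
  not contain the shorter sums, so each shorter length is removed.\<close>

definition word_sphere :: "'a :: comm_monoid_add set \<Rightarrow> nat \<Rightarrow> 'a set" where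
  "word_sphere A n = sumset n A - (\<Union>k<n. sumset k A)"

definition word_growth :: "'a :: comm_monoid_add set \<Rightarrow> rat fps" where
  "word_growth A = Abs_fps (\<lambda>n. of_nat (card (word_sphere A n)))"

lemma sumset_0 [simp]: "sumset 0 A = {0}"
  by (auto simp: sumset_def)

lemma sumset_Suc: "sumset (Suc n) A = (\<lambda>(a, z). a + z) ` (A \<times> sumset n A)"
proof (intro equalityI subsetI)
  fix z assume "z \<in> sumset (Suc n) A"
  then obtain ws where "z = sum_list ws" "length ws = Suc n" "set ws \<subseteq> A"
    by (auto simp: sumset_def)
  then obtain a vs where "z = a + sum_list vs" "a \<in> A" "length vs = n" "set vs \<subseteq> A"
    by (cases ws) auto
  then show "z \<in> (\<lambda>(a, z). a + z) ` (A \<times> sumset n A)"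
    by (auto simp: sumset_def)
next
  fix z assume "z \<in> (\<lambda>(a, z). a + z) ` (A \<times> sumset n A)"
  then obtain a vs where "z = a + sum_list vs" "a \<in> A" "length vs = n" "set vs \<subseteq> A"
    by (auto simp: sumset_def)
  then have "z = sum_list (a # vs)" "length (a # vs) = Suc n" "set (a # vs) \<subseteq> A"
    by auto
  then show "z \<in> sumset (Suc n) A"
    unfolding sumset_def by blast
qed

lemma sumset_SucI: "a \<in> A \<Longrightarrow> z \<in> sumset n A \<Longrightarrow> a + z \<in> sumset (Suc n) A"
  unfolding sumset_Suc by (rule image_eqI[of _ _ "(a, z)"]) auto

lemma finite_sumset: "finite A \<Longrightarrow> finite (sumset n A)"
  by (induction n) (auto simp: sumset_Suc)

lemma finite_word_sphere: "finite A \<Longrightarrow> finite (word_sphere A n)"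
  by (simp add: word_sphere_def finite_sumset)

lemma sumset_Un:
  "z \<in> sumset n (A \<union> B) \<longleftrightarrow> (\<exists>i j a b. i + j = n \<and> a \<in> sumset i A \<and> b \<in> sumset j B \<and> z = a + b)"
proof
  assume "z \<in> sumset n (A \<union> B)"
  then show "\<exists>i j a b. i + j = n \<and> a \<in> sumset i A \<and> b \<in> sumset j B \<and> z = a + b"
  proof (induction n arbitrary: z)
    case (Suc n)
    then obtain c w where w: "z = c + w" "c \<in> A \<union> B" "w \<in> sumset n (A \<union> B)"
      by (auto simp: sumset_Suc)
    with Suc.IH obtain i j a b where ab: "i + j = n" "a \<in> sumset i A" "b \<in> sumset j B" "w = a + b"
      by metis
    show ?case
    proof (cases "c \<in> A")
      case True
      then have "Suc i + j = Suc n" "c + a \<in> sumset (Suc i) A" "z = (c + a) + b"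
        using ab w by (auto intro: sumset_SucI simp: add.assoc)
      then show ?thesis
        using ab(3) by blast
    next
      case False
      then have "i + Suc j = Suc n" "c + b \<in> sumset (Suc j) B" "z = a + (c + b)"
        using ab w by (auto intro: sumset_SucI simp: add.left_commute)
      then show ?thesis
        using ab(2) by blast
    qed
  qed auto
next
  assume "\<exists>i j a b. i + j = n \<and> a \<in> sumset i A \<and> b \<in> sumset j B \<and> z = a + b"
  then obtain vs ws where "length vs + length ws = n" "set vs \<subseteq> A" "set ws \<subseteq> B"
      "z = sum_list vs + sum_list ws"
    by (auto simp: sumset_def)
  then have "length (vs @ ws) = n" "set (vs @ ws) \<subseteq> A \<union> B" "z = sum_list (vs @ ws)"
    by auto
  then show "z \<in> sumset n (A \<union> B)"
    unfolding sumset_def by blast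
qed

lemma word_sphere_le: "z \<in> word_sphere A n \<Longrightarrow> z \<in> sumset k A \<Longrightarrow> n \<le> k"
  by (force simp: word_sphere_def not_less[symmetric])

lemma word_sphere_subset_sumset: "word_sphere A n \<subseteq> sumset n A"
  by (auto simp: word_sphere_def)

lemma word_sphere_disjoint: "i \<noteq> j \<Longrightarrow> word_sphere A i \<inter> word_sphere A j = {}"
  by (cases i j rule: linorder_cases) (auto simp: word_sphere_def)

text \<open>Unique decomposition makes lengths add, so a sphere of the union is a disjoint union of
  products of spheres, as in the Cauchy product. \<open>direct\<close> covers all lengths because
  another word for the same element may split differently.\<close>

lemma word_growth_Un:
  assumes "finite A" "finite B"
    and direct: "\<And>i j i' j' a b a' b'. \<lbrakk>a \<in> sumset i A; b \<in> sumset j B; a' \<in> sumset i' A;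
      b' \<in> sumset j' B; a + b = a' + b'\<rbrakk> \<Longrightarrow> a = a' \<and> b = b'"
  shows "word_growth (A \<union> B) = word_growth A * word_growth B"
proof (rule fps_ext)
  fix n
  define D where "D = (\<Union>i\<in>{0..n}. word_sphere A i \<times> word_sphere B (n - i))"
  have "bij_betw (\<lambda>(a, b). a + b) D (word_sphere (A \<union> B) n)"
    unfolding bij_betw_def
  proof (intro conjI equalityI subsetI)
    show "inj_on (\<lambda>(a, b). a + b) D"
      using direct by (auto simp: inj_on_def D_def word_sphere_def)
  next
    fix z assume "z \<in> (\<lambda>(a, b). a + b) ` D"
    then obtain a b i where ab: "i \<le> n" "a \<in> word_sphere A i" "b \<in> word_sphere B (n - i)" "z = a + b"
      by (auto simp: D_def)
    then have mem: "a \<in> sumset i A" "b \<in> sumset (n - i) B"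
      using word_sphere_subset_sumset by blast+
    have "z \<notin> sumset k (A \<union> B)" if "k < n" for k
    proof
      assume "z \<in> sumset k (A \<union> B)"
      then obtain i' j' a' b' where *: "i' + j' = k" "a' \<in> sumset i' A" "b' \<in> sumset j' B" "z = a' + b'"
        by (auto simp: sumset_Un)
      have "a = a' \<and> b = b'"
        using direct[OF mem *(2,3)] *(4) ab(4) by simp
      with * ab have "i \<le> i'" "n - i \<le> j'"
        using word_sphere_le by blast+
      then show False
        using *(1) that ab(1) by linarith
    qed
    moreover have "z \<in> sumset n (A \<union> B)"
      unfolding sumset_Un using ab mem by (metis le_add_diff_inverse)
    ultimately show "z \<in> word_sphere (A \<union> B) n"
      by (auto simp: word_sphere_def)
  next
    fix z assume z: "z \<in> word_sphere (A \<union> B) n"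
    then obtain i j a b where ab: "i + j = n" "a \<in> sumset i A" "b \<in> sumset j B" "z = a + b"
      by (auto simp: word_sphere_def sumset_Un)
    \<comment> \<open>A shorter word for either summand would shorten the word for
      \<open>z\<close>.\<close>
    have min: "i' + j' \<ge> n" if "a \<in> sumset i' A" "b \<in> sumset j' B" for i' j'
    proof (rule ccontr)
      assume "\<not> i' + j' \<ge> n"
      moreover have "z \<in> sumset (i' + j') (A \<union> B)"
        unfolding sumset_Un using that ab(4) by blast
      ultimately show False
        using z by (auto simp: word_sphere_def)
    qed
    have "a \<in> word_sphere A i"
      using ab min[of _ j] by (fastforce simp: word_sphere_def)
    moreover have "b \<in> word_sphere B (n - i)"
      using ab min[of i] by (fastforce simp: word_sphere_def)
    ultimately have "(a, b) \<in> D"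
      using ab(1) by (auto simp: D_def)
    then show "z \<in> (\<lambda>(a, b). a + b) ` D"
      using ab(4) by force
  qed
  then have "card (word_sphere (A \<union> B) n) = card D"
    by (simp add: bij_betw_same_card)
  also have "\<dots> = (\<Sum>i\<in>{0..n}. card (word_sphere A i \<times> word_sphere B (n - i)))"
    unfolding D_def
  proof (rule card_UN_disjoint)
    show "\<forall>i\<in>{0..n}. \<forall>j\<in>{0..n}. i \<noteq> j \<longrightarrow>
        (word_sphere A i \<times> word_sphere B (n - i)) \<inter> (word_sphere A j \<times> word_sphere B (n - j)) = {}"
      using word_sphere_disjoint[of _ _ A] by blast
  qed (use assms in \<open>auto simp: finite_word_sphere\<close>)
  finally show "fps_nth (word_growth (A \<union> B)) n = fps_nth (word_growth A * word_growth B) n"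
    by (simp add: word_growth_def fps_mult_nth card_cartesian_product)
qed

lemma word_growth_empty: "word_growth {} = 1"
proof (rule fps_ext)
  show "fps_nth (word_growth {}) n = fps_nth 1 n" for n
    by (cases n) (auto simp: word_growth_def word_sphere_def sumset_Suc)
qed

lemma sumset_scale:
  fixes c :: "'a :: semiring_0"
  shows "sumset n ((*) c ` A) = (*) c ` sumset n A"
  by (induction n) (force simp: sumset_Suc algebra_simps image_iff)+

text \<open>Identifies the growth of each translate \<open>\<zeta>\<^sub>m^j M\<^sub>r\<close> with
  that of \<open>M\<^sub>r\<close>.\<close>

lemma word_growth_scale:
  fixes c :: "'a :: field"
  assumes "c \<noteq> 0"
  shows "word_growth ((*) c ` A) = word_growth A"
proof -
  have inj: "inj ((*) c)"
    using assms by (simp add: inj_on_def)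
  have "word_sphere ((*) c ` A) n = (*) c ` word_sphere A n" for n
    unfolding word_sphere_def sumset_scale by (simp add: image_set_diff[OF inj] image_UN)
  moreover have "card ((*) c ` X) = card X" for X
    by (rule card_image) (rule inj_on_subset[OF inj], simp)
  ultimately show ?thesis
    by (simp add: word_growth_def)
qed

section \<open>Coordination sequences as sphere sizes\<close>

lemma word_length_eq_enat_iff: "word_length m z = enat n \<longleftrightarrow> z \<in> word_sphere (unity_roots m) n"
proof -
  define L where "L = {n. z \<in> sumset n (unity_roots m)}"
  have "word_length m z = Inf (enat ` L)"
    unfolding word_length_def L_def sumset_def by (intro arg_cong[of _ _ Inf]) auto
  moreover have "Inf (enat ` L) = enat n \<longleftrightarrow> n \<in> L \<and> (\<forall>k<n. k \<notin> L)"
  proof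
    assume *: "Inf (enat ` L) = enat n"
    \<comment> \<open>The infimum of the empty set is infinite in \<open>enat\<close>, so a finite
      infimum comes from a nonempty set and is attained.\<close>
    then have "L \<noteq> {}"
      by (auto simp: top_enat_def)
    then have "Inf (enat ` L) \<in> enat ` L"
      unfolding Inf_enat_def by (auto intro: LeastI)
    moreover have "k \<notin> L" if "k < n" for k
      using * that by (metis Inf_lower enat_ord_simps(1) image_eqI linorder_not_le)
    ultimately show "n \<in> L \<and> (\<forall>k<n. k \<notin> L)"
      using * by auto
  next
    assume "n \<in> L \<and> (\<forall>k<n. k \<notin> L)"
    then show "Inf (enat ` L) = enat n"
      by (intro antisym Inf_lower Inf_greatest) (auto simp: not_less[symmetric])
  qed
  ultimately show ?thesis
    by (auto simp: L_def word_sphere_def)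
qed

lemma cyclotomic_lattice_eq: "cyclotomic_lattice m = range (\<lambda>p. int_poly_eval p (zeta m))"
  by (simp add: cyclotomic_lattice_def int_poly_eval_def)

text \<open>Makes the lattice condition in \<open>coordination_sequence\<close> automatic for
  elements of finite word length.\<close>

lemma sumset_unity_roots_subset_lattice:
  assumes "m > 0"
  shows "sumset n (unity_roots m) \<subseteq> cyclotomic_lattice m"
proof (induction n)
  case 0
  then show ?case
    by (auto simp: cyclotomic_lattice_eq intro!: image_eqI[of _ _ 0])
next
  case (Suc n)
  show ?case
  proof
    fix z assume "z \<in> sumset (Suc n) (unity_roots m)"
    then obtain k w where "z = zeta m ^ k + w" "w \<in> sumset n (unity_roots m)"
      by (auto simp: sumset_Suc unity_roots_eq_image[OF assms])
    with Suc obtain p where "z = zeta m ^ k + int_poly_eval p (zeta m)"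
      by (auto simp: cyclotomic_lattice_eq)
    then have "z = int_poly_eval (monom 1 k + p) (zeta m)"
      by simp
    then show "z \<in> cyclotomic_lattice m"
      unfolding cyclotomic_lattice_eq by (rule range_eqI)
  qed
qed

lemma growth_series_eq_word_growth:
  assumes "m > 0"
  shows "growth_series m = word_growth (unity_roots m)"
proof -
  have "{z \<in> cyclotomic_lattice m. word_length m z = enat n} = word_sphere (unity_roots m) n" for n
    using sumset_unity_roots_subset_lattice[OF assms, of n]
    by (auto simp: word_length_eq_enat_iff word_sphere_def)
  then show ?thesis
    by (simp add: growth_series_def coordination_sequence_def word_growth_def)
qed

text \<open>The \<open>q\<close> translates are added one at a time; independence of the powers of
  \<open>zeta (q * r)\<close> makes each union direct.\<close>

lemma growth_series_mult:
  assumes "q > 0" "r > 0" "\<And>p. prime p \<Longrightarrow> p dvd q \<Longrightarrow> p dvd r"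
  shows "growth_series (q * r) = growth_series r ^ q"
proof -
  define z where "z = zeta (q * r)"
  define T where "T = (\<lambda>i. \<Union>j<i. (*) (z ^ j) ` unity_roots r)"
  have fin: "finite (T i)" for i
    using assms(2) by (auto simp: T_def finite_unity_roots)
  have span_T: "\<exists>P. a = (\<Sum>j<i. z ^ j * int_poly_eval (P j) (zeta r))" if "a \<in> sumset n (T i)" for a n i
    using that
  proof (induction n arbitrary: a)
    case 0
    then have "a = (\<Sum>j<i. z ^ j * int_poly_eval 0 (zeta r))"
      by simp
    then show ?case
      by (rule exI[of _ "\<lambda>_. 0"])
  next
    case (Suc n)
    then obtain w b where w: "a = w + b" "w \<in> T i" "b \<in> sumset n (T i)"
      by (auto simp: sumset_Suc)
    from Suc.IH[OF w(3)] obtain P where P: "b = (\<Sum>j<i. z ^ j * int_poly_eval (P j) (zeta r))"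
      by blast
    from w(2) obtain k l where kl: "k < i" "w = z ^ k * zeta r ^ l"
      by (auto simp: T_def unity_roots_eq_image[OF assms(2)])
    define P' where "P' = P(k := P k + monom 1 l)"
    have "(\<Sum>j<i. z ^ j * int_poly_eval (P' j) (zeta r)) =
        (\<Sum>j<i. z ^ j * int_poly_eval (P j) (zeta r) + (if j = k then w else 0))"
      by (intro sum.cong refl) (auto simp: P'_def kl algebra_simps)
    also have "\<dots> = a"
      using kl(1) by (simp add: sum.distrib P w(1))
    finally show ?case
      by metis
  qed
  have span_unity: "\<exists>p. b = z ^ i * int_poly_eval p (zeta r)"
    if "b \<in> sumset n ((*) (z ^ i) ` unity_roots r)" for b n i
    using that sumset_unity_roots_subset_lattice[OF assms(2), of n]
    unfolding sumset_scale by (auto simp: cyclotomic_lattice_eq)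
  have growth_T: "word_growth (T i) = word_growth (unity_roots r) ^ i" if "i \<le> q" for i
    using that
  proof (induction i)
    case 0
    then show ?case
      by (simp add: T_def word_growth_empty)
  next
    case (Suc i)
    have "T (Suc i) = T i \<union> (*) (z ^ i) ` unity_roots r"
      by (simp add: T_def lessThan_Suc Un_commute)
    also have "word_growth \<dots> = word_growth (T i) * word_growth ((*) (z ^ i) ` unity_roots r)"
    proof (rule word_growth_Un)
      fix k l k' l' a b a' b'
      assume *: "a \<in> sumset k (T i)" "b \<in> sumset l ((*) (z ^ i) ` unity_roots r)"
        "a' \<in> sumset k' (T i)" "b' \<in> sumset l' ((*) (z ^ i) ` unity_roots r)" "a + b = a' + b'"
      obtain P P' where P: "a = (\<Sum>j<i. z ^ j * int_poly_eval (P j) (zeta r))"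
          "a' = (\<Sum>j<i. z ^ j * int_poly_eval (P' j) (zeta r))"
        using span_T[OF *(1)] span_T[OF *(3)] by blast
      obtain p p' where p: "b = z ^ i * int_poly_eval p (zeta r)" "b' = z ^ i * int_poly_eval p' (zeta r)"
        using span_unity[OF *(2)] span_unity[OF *(4)] by blast
      \<comment> \<open>The relation has only \<open>i + 1\<close> terms and is padded with zeros to
        the \<open>q\<close> terms of the independence lemma. Its top term alone gives
        \<open>b = b'\<close>, and then \<open>a = a'\<close> by cancellation.\<close>
      define Q where "Q = (\<lambda>j. if j < i then P j - P' j else if j = i then p - p' else 0)"
      have "(\<Sum>j<q. z ^ j * int_poly_eval (Q j) (zeta r)) =
          (\<Sum>j<Suc i. z ^ j * int_poly_eval (Q j) (zeta r))"
        using Suc.prems by (intro sum.mono_neutral_right) (auto simp: Q_def)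
      also have "\<dots> = (a - a') + (b - b')"
        by (simp add: Q_def P p right_diff_distrib sum_subtractf)
      also have "\<dots> = 0"
        using *(5) by (simp add: algebra_simps)
      finally have "int_poly_eval (Q i) (zeta r) = 0"
        using assms Suc.prems unfolding z_def
        by (intro zeta_powers_independent[of q r Q i]) auto
      then have "b = b'"
        by (simp add: Q_def p)
      then show "a = a' \<and> b = b'"
        using *(5) by simp
    qed (use fin assms(2) in \<open>auto simp: finite_unity_roots\<close>)
    also have "word_growth ((*) (z ^ i) ` unity_roots r) = word_growth (unity_roots r)"
      by (rule word_growth_scale) (simp add: z_def)
    finally show ?case
      using Suc by simp
  qed
  have "unity_roots (q * r) = T q"
  proof (intro equalityI subsetI)
    fix w assume "w \<in> unity_roots (q * r)"
    then obtain k where k: "w = z ^ k" "k < q * r"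
      using assms by (auto simp: unity_roots_eq_image z_def)
    \<comment> \<open>Division of the exponent by \<open>q\<close>: the remainder selects the
      translate, the quotient an \<open>r\<close>-th root of unity.\<close>
    have "w = z ^ (k mod q) * z ^ (q * (k div q))"
      by (simp add: k flip: power_add)
    also have "z ^ (q * (k div q)) = zeta r ^ (k div q)"
      using assms(1) by (simp add: power_mult z_def zeta_mult_power)
    finally have "w = z ^ (k mod q) * zeta r ^ (k div q)" .
    moreover have "zeta r ^ (k div q) \<in> unity_roots r"
      by (rule zeta_power_in_unity_roots)
    ultimately show "w \<in> T q"
      using assms(1) unfolding T_def by (intro UN_I[of "k mod q"] image_eqI) auto
  next
    fix w assume "w \<in> T q"
    then obtain j v where w: "w = z ^ j * v" "v ^ r = 1"
      by (auto simp: T_def unity_roots_def)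
    have "w ^ (q * r) = (z ^ (q * r)) ^ j * (v ^ r) ^ q"
      unfolding w(1) power_mult_distrib by (metis mult.commute power_mult)
    then show "w \<in> unity_roots (q * r)"
      by (simp add: unity_roots_def z_def w(2))
  qed
  then show ?thesis
    using growth_T[of q] assms by (simp add: growth_series_eq_word_growth)
qed

section \<open>Degree series of down-closed sets of exponent vectors\<close>

definition down_closed :: "nat list set \<Rightarrow> bool" where
  "down_closed D \<longleftrightarrow> (\<forall>x\<in>D. \<forall>y. list_all2 (\<le>) y x \<longrightarrow> y \<in> D)"

text \<open>For a down-closed \<open>D\<close> of vectors of length \<open>k\<close>, the complement
  is a monomial ideal in \<open>k\<close> variables and this is the Hilbert series of the
  quotient.\<close>

definition degree_series :: "nat list set \<Rightarrow> rat fps" where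
  "degree_series D = Abs_fps (\<lambda>n. of_nat (card {x \<in> D. sum_list x = n}))"

lemma down_closedD: "down_closed D \<Longrightarrow> x \<in> D \<Longrightarrow> list_all2 (\<le>) y x \<Longrightarrow> y \<in> D"
  by (auto simp: down_closed_def)

section \<open>Dickson's lemma and the chain condition\<close>

lemma nondecreasing_subsequence:
  fixes s :: "nat \<Rightarrow> nat"
  obtains f :: "nat \<Rightarrow> nat" where "strict_mono f" "mono (\<lambda>n. s (f n))"
proof -
  obtain f :: "nat \<Rightarrow> nat" where f: "strict_mono f" "monoseq (\<lambda>n. s (f n))"
    using seq_monosub by blast
  show ?thesis
  proof (cases "\<forall>m. \<forall>n\<ge>m. s (f m) \<le> s (f n)")
    case True
    then show ?thesis
      using f by (intro that[of f]) (auto simp: mono_def)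
  next
    case False
    then have dec: "s (f n) \<le> s (f m)" if "m \<le> n" for m n
      using f(2) that by (auto simp: monoseq_def)
    \<comment> \<open>A nonincreasing sequence of naturals is constant once it attains its
      minimum.\<close>
    obtain N where N: "\<And>n. s (f N) \<le> s (f n)"
      using arg_min_nat_le[of "\<lambda>_. True" _ "\<lambda>n. s (f n)"] by blast
    have "s (f (n + N)) = s (f N)" for n
      using N dec by (simp add: antisym)
    then show ?thesis
      using f(1) by (intro that[of "\<lambda>n. f (n + N)"]) (auto simp: mono_def strict_mono_def)
  qed
qed

text \<open>A subsequence good for the tails is refined to one on which the heads are nondecreasing
  too.\<close>

lemma dickson:
  assumes "\<And>n :: nat. length (s n) = k"
  obtains f :: "nat \<Rightarrow> nat" where "strict_mono f"
    "\<And>i j. i \<le> j \<Longrightarrow> list_all2 (\<le>) (s (f i) :: nat list) (s (f j))"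
  using assms
proof (induction k arbitrary: s thesis)
  case 0
  then show ?case
    by (intro "0.prems"(1)[of id]) (auto simp: strict_mono_def)
next
  case (Suc k)
  obtain f :: "nat \<Rightarrow> nat" where f: "strict_mono f"
      "\<And>i j. i \<le> j \<Longrightarrow> list_all2 (\<le>) (tl (s (f i))) (tl (s (f j)))"
    using Suc.IH[of "\<lambda>n. tl (s n)"] Suc.prems(2) by auto
  obtain g :: "nat \<Rightarrow> nat" where g: "strict_mono g" "mono (\<lambda>n. hd (s (f (g n))))"
    by (rule nondecreasing_subsequence[of "\<lambda>n. hd (s (f n))"]) blast
  show ?case
  proof (rule Suc.prems(1))
    show "strict_mono (\<lambda>n. f (g n))"
      using f(1) g(1) by (simp add: strict_mono_def)
    fix i j :: nat assume "i \<le> j"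
    have cons: "s n = hd (s n) # tl (s n)" for n
      using Suc.prems(2)[of n] by (cases "s n") auto
    have "hd (s (f (g i))) \<le> hd (s (f (g j)))"
      using g(2) \<open>i \<le> j\<close> by (simp add: mono_def)
    moreover have "list_all2 (\<le>) (tl (s (f (g i)))) (tl (s (f (g j))))"
      using f(2) g(1) \<open>i \<le> j\<close> by (simp add: strict_mono_less_eq)
    ultimately show "list_all2 (\<le>) (s (f (g i))) (s (f (g j)))"
      by (subst (1 2) cons) simp
  qed
qed

text \<open>Otherwise every \<open>D N\<close> has a point \<open>s N\<close> that leaves the chain
  later. By Dickson's lemma some late point lies above an early one, which by down-closure could not
  have left.\<close>

lemma decreasing_down_closed_stabilizes:
  assumes "\<And>j :: nat. down_closed (D j)" "\<And>j x. x \<in> D j \<Longrightarrow> length x = k"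
    and dec: "\<And>i j. i \<le> j \<Longrightarrow> D j \<subseteq> D i"
  obtains N where "\<And>j. j \<ge> N \<Longrightarrow> D j = D N"
proof (rule ccontr)
  assume "\<not> thesis"
  then have "\<exists>j\<ge>N. \<exists>x. x \<in> D N \<and> x \<notin> D j" for N
    using that dec by (metis subsetI subset_antisym)
  then obtain g s where gs: "\<And>N. g N \<ge> N" "\<And>N. s N \<in> D N" "\<And>N. s N \<notin> D (g N)"
    by metis
  obtain f :: "nat \<Rightarrow> nat" where f: "strict_mono f" "\<And>i j. i \<le> j \<Longrightarrow> list_all2 (\<le>) (s (f i)) (s (f j))"
    using dickson[of s k] gs(2) assms(2) by blast
  define i where "i = g (f 0)"
  have "i \<le> f i"
    using f(1) by (rule strict_mono_imp_increasing)
  then have "s (f i) \<in> D (g (f 0))"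
    using gs(2) dec unfolding i_def by blast
  then have "s (f 0) \<in> D (g (f 0))"
    using assms(1) f(2)[of 0 i] by (metis down_closedD le0)
  then show False
    using gs(3) by blast
qed

lemma finite_lists_sum: "finite {x :: nat list. length x = k \<and> sum_list x = n}"
proof (rule finite_subset)
  show "{x. length x = k \<and> sum_list x = n} \<subseteq> {x. set x \<subseteq> {..n} \<and> length x = k}"
    using member_le_sum_list by auto
  show "finite {x. set x \<subseteq> {..n} \<and> length x = k}"
    by (rule finite_lists_length_eq) simp
qed

text \<open>Vectors are split by whether the first exponent is 0; lowering a positive one by 1 costs
  the factor \<open>fps_X\<close>.\<close>

lemma degree_series_Cons:
  assumes "\<And>x. x \<in> D \<Longrightarrow> length x = Suc k"
  shows "degree_series D = degree_series {x. 0 # x \<in> D} +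
    fps_X * degree_series {j # x |j x. Suc j # x \<in> D}"
proof (rule fps_ext)
  fix n
  define X where "X = {x. 0 # x \<in> D \<and> sum_list x = n}"
  define Y where "Y = {j # x |j x. Suc j # x \<in> D \<and> Suc (j + sum_list x) = n}"
  define up where "up = (\<lambda>y :: nat list. Suc (hd y) # tl y)"
  have D: "{x \<in> D. sum_list x = n} = Cons 0 ` X \<union> up ` Y"
  proof (intro equalityI subsetI)
    fix y assume y: "y \<in> {x \<in> D. sum_list x = n}"
    then obtain j x where jx: "y = j # x"
      using assms by (metis length_Suc_conv mem_Collect_eq)
    show "y \<in> Cons 0 ` X \<union> up ` Y"
    proof (cases j)
      case (Suc i)
      then have "y = up (i # x)" "i # x \<in> Y"
        using y jx by (auto simp: Y_def up_def)
      then show ?thesis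
        by blast
    qed (use y jx in \<open>auto simp: X_def\<close>)
  qed (auto simp: X_def Y_def up_def)
  have fin: "finite {x \<in> D. sum_list x = n}"
    using assms by (intro finite_subset[OF _ finite_lists_sum[of "Suc k" n]]) auto
  have inj: "inj_on up Y"
  proof (rule inj_onI)
    fix y y' assume "y \<in> Y" "y' \<in> Y" "up y = up y'"
    then have "y \<noteq> []" "y' \<noteq> []" "hd y = hd y'" "tl y = tl y'"
      unfolding Y_def up_def by blast+
    then show "y = y'"
      by (simp add: list.expand)
  qed
  have "card {x \<in> D. sum_list x = n} = card (Cons 0 ` X) + card (up ` Y)"
    unfolding D
  proof (rule card_Un_disjoint)
    show "finite (Cons 0 ` X)" "finite (up ` Y)"
      using fin unfolding D by simp_all
  qed (auto simp: up_def)
  also have "card (Cons 0 ` X) = card X"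
    by (intro card_image) (auto simp: inj_on_def)
  also have "card (up ` Y) = card Y"
    using inj by (rule card_image)
  finally have card: "card {x \<in> D. sum_list x = n} = card X + card Y" .
  show "fps_nth (degree_series D) n = fps_nth (degree_series {x. 0 # x \<in> D} +
      fps_X * degree_series {j # x |j x. Suc j # x \<in> D}) n"
  proof (cases n)
    case 0
    then have "Y = {}"
      by (auto simp: Y_def)
    then show ?thesis
      using card 0 by (simp add: degree_series_def X_def)
  next
    case (Suc n')
    then have "Y = {x \<in> {j # x |j x. Suc j # x \<in> D}. sum_list x = n'}"
      by (auto simp: Y_def)
    then show ?thesis
      using card Suc by (simp add: degree_series_def X_def)
  qed
qed

text \<open>The slices at a fixed first exponent decrease as it grows and stabilize at some
  \<open>N\<close>. An inner induction on \<open>N\<close> peels off the slices before that.\<close>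

lemma degree_series_down_closed:
  assumes "down_closed D" "\<And>x. x \<in> D \<Longrightarrow> length x = k"
  shows "\<exists>h. degree_series D * (1 - fps_X) ^ k = fps_of_poly h"
  using assms
proof (induction k arbitrary: D)
  case 0
  then have "D = {} \<or> D = {[]}"
    by auto
  moreover have "degree_series {} = fps_of_poly 0"
    by (rule fps_ext) (simp add: degree_series_def)
  moreover have "degree_series {[]} = fps_of_poly 1"
  proof (rule fps_ext)
    fix n
    have "{x \<in> {[] :: nat list}. sum_list x = n} = (if n = 0 then {[]} else {})"
      by auto
    then show "fps_nth (degree_series {[]}) n = fps_nth (fps_of_poly 1) n"
      by (simp add: degree_series_def)
  qed
  ultimately have "degree_series D = fps_of_poly 0 \<or> degree_series D = fps_of_poly 1"
    by metis
  then show ?case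
    by auto
next
  case (Suc k)
  define S where "S = (\<lambda>D :: nat list set. \<lambda>j. {x. j # x \<in> D})"
  have S_down: "down_closed (S D j)" if "down_closed D" for D j
    using that by (auto simp: down_closed_def S_def)
  have S_length: "length x = k" if "\<And>x. x \<in> D \<Longrightarrow> length x = Suc k" "x \<in> S D j" for D j x
    using that by (force simp: S_def)
  have S_dec: "S D j \<subseteq> S D i" if "down_closed D" "i \<le> j" for D i j
    using that by (auto simp: S_def intro: down_closedD list_all2_refl)
  obtain N where "\<And>j. j \<ge> N \<Longrightarrow> S D j = S D N"
    using decreasing_down_closed_stabilizes[of "S D" k] S_down S_length S_dec Suc.prems by metis
  then show ?case
    using Suc.prems
  proof (induction N arbitrary: D)
    case 0
    have "S D j = S D 0" for j
      using "0.prems"(1) by simp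
    then have "j # x \<in> D \<longleftrightarrow> 0 # x \<in> D" for j x
      unfolding S_def by blast
    then have iff: "Suc j # x \<in> D \<longleftrightarrow> j # x \<in> D" for j x
      by metis
    \<comment> \<open>All slices agree, so the shift maps \<open>D\<close> to itself and the series
      is that of one slice divided by \<open>1 - fps_X\<close>.\<close>
    have "{j # x |j x. Suc j # x \<in> D} = D"
    proof (intro equalityI subsetI)
      fix y assume "y \<in> D"
      moreover from this obtain j x where "y = j # x"
        using "0.prems"(3) by (metis length_Suc_conv)
      ultimately show "y \<in> {j # x |j x. Suc j # x \<in> D}"
        using iff by blast
    qed (auto simp: iff)
    then have "degree_series D = degree_series (S D 0) + fps_X * degree_series D"
      using degree_series_Cons[of D k] "0.prems"(3) by (simp add: S_def)
    then have "degree_series D * (1 - fps_X) = degree_series (S D 0)"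
      by (simp add: algebra_simps)
    moreover obtain h where "degree_series (S D 0) * (1 - fps_X) ^ k = fps_of_poly h"
      using Suc.IH[of "S D 0"] S_down S_length "0.prems" by metis
    ultimately have "degree_series D * (1 - fps_X) ^ Suc k = fps_of_poly h"
      by (simp flip: mult.assoc)
    then show ?case
      by blast
  next
    case (Suc N)
    \<comment> \<open>Shifting the first exponent lowers the stabilization index by one.\<close>
    define D' where "D' = {j # x |j x. Suc j # x \<in> D}"
    have "S D' j = S D (Suc j)" for j
      by (auto simp: S_def D'_def)
    then have stab: "S D' j = S D' N" if "j \<ge> N" for j
      using Suc.prems(1)[of "Suc j"] that by simp
    have down: "down_closed D'"
      using Suc.prems(2) unfolding down_closed_def D'_def
      by (fastforce simp: list_all2_Cons2)
    have len: "length x = Suc k" if "x \<in> D'" for x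
      using that Suc.prems(3) by (force simp: D'_def)
    obtain h where h: "degree_series D' * (1 - fps_X) ^ Suc k = fps_of_poly h"
      using Suc.IH[of D'] stab down len by blast
    obtain h' where h': "degree_series (S D 0) * (1 - fps_X) ^ k = fps_of_poly h'"
      using \<open>\<And>D. down_closed D \<Longrightarrow> (\<And>x. x \<in> D \<Longrightarrow> length x = k) \<Longrightarrow>
        \<exists>h. degree_series D * (1 - fps_X) ^ k = fps_of_poly h\<close>[of "S D 0"]
        S_down S_length Suc.prems by metis
    have "degree_series D = degree_series (S D 0) + fps_X * degree_series D'"
      using degree_series_Cons[of D k] Suc.prems(3) by (simp add: S_def D'_def)
    then have "degree_series D * (1 - fps_X) ^ Suc k =
        (degree_series (S D 0) * (1 - fps_X) ^ k) * (1 - fps_X) +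
        fps_X * (degree_series D' * (1 - fps_X) ^ Suc k)"
      by (simp add: algebra_simps)
    also have "\<dots> = fps_of_poly (h' * (1 - monom 1 1) + monom 1 1 * h)"
      unfolding h h' by (simp add: fps_of_poly_add fps_of_poly_mult fps_of_poly_diff fps_of_poly_monom)
    finally show ?case
      by blast
  qed
qed

section \<open>Exponent vectors of words\<close>

definition nat_combination :: "nat list \<Rightarrow> 'a :: comm_semiring_1 list \<Rightarrow> 'a" where
  "nat_combination xs as = (\<Sum>(n, a)\<leftarrow>zip xs as. of_nat n * a)"

lemma nat_combination_Nil [simp]: "nat_combination [] as = 0"
  by (simp add: nat_combination_def)

lemma nat_combination_Cons [simp]:
  "nat_combination (n # xs) (a # as) = of_nat n * a + nat_combination xs as"
  by (simp add: nat_combination_def)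

lemma sumset_singleton:
  fixes a :: "'a :: comm_semiring_1"
  shows "sumset n {a} = {of_nat n * a}"
  by (induction n) (auto simp: sumset_Suc algebra_simps)

text \<open>By commutativity a word enters its sum only through the multiplicities of the
  generators.\<close>

lemma sumset_set_iff:
  fixes as :: "'a :: comm_semiring_1 list"
  shows "z \<in> sumset n (set as) \<longleftrightarrow>
    (\<exists>xs. length xs = length as \<and> sum_list xs = n \<and> nat_combination xs as = z)"
proof (induction as arbitrary: n z)
  case Nil
  then show ?case
    by (cases n) (auto simp: sumset_Suc)
next
  case (Cons a as)
  have "z \<in> sumset n (set (a # as)) \<longleftrightarrow> z \<in> sumset n ({a} \<union> set as)"
    by simp
  also have "\<dots> \<longleftrightarrow> (\<exists>i j c. i + j = n \<and> c \<in> sumset j (set as) \<and> z = of_nat i * a + c)"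
    unfolding sumset_Un sumset_singleton by blast
  also have "\<dots> \<longleftrightarrow> (\<exists>i xs. length xs = length as \<and> i + sum_list xs = n \<and>
      of_nat i * a + nat_combination xs as = z)"
    unfolding Cons.IH by blast
  also have "\<dots> \<longleftrightarrow> (\<exists>ys. length ys = length (a # as) \<and> sum_list ys = n \<and>
      nat_combination ys (a # as) = z)"
    (is "?lhs \<longleftrightarrow> ?rhs")
  proof
    assume ?lhs
    then obtain i xs where "length xs = length as" "i + sum_list xs = n"
        "of_nat i * a + nat_combination xs as = z"
      by blast
    then show ?rhs
      by (intro exI[of _ "i # xs"]) simp
  next
    assume ?rhs
    then obtain i xs where "length (i # xs) = length (a # as)" "sum_list (i # xs) = n"
        "nat_combination (i # xs) (a # as) = z"
      by (metis length_Suc_conv list.size(4))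
    then show ?lhs
      by auto
  qed
  finally show ?case .
qed

lemma nat_combination_add:
  assumes "length x = length as" "length d = length as"
  shows "nat_combination (map2 (+) x d) as = nat_combination x as + nat_combination d as"
  using assms
proof (induction as arbitrary: x d)
  case (Cons a as)
  then obtain i x' j d' where "x = i # x'" "d = j # d'"
    by (metis length_Suc_conv)
  then show ?case
    using Cons by (simp add: algebra_simps)
qed simp

lemma sum_list_map2_add:
  fixes x d :: "nat list"
  assumes "length x = length d"
  shows "sum_list (map2 (+) x d) = sum_list x + sum_list d"
  using assms by (induction x d rule: list_induct2) auto

text \<open>Translation invariance, which makes the set of minimal exponent vectors
  down-closed.\<close>

lemma lex_map2_add:
  fixes x y d :: "nat list"
  assumes "(x, y) \<in> lex less_than" "length d = length y"
  shows "(map2 (+) x d, map2 (+) y d) \<in> lex less_than"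
proof -
  have "length x = length y"
    using assms(1) by (auto simp: lex_conv)
  then show ?thesis
    using assms
  proof (induction x y arbitrary: d rule: list_induct2)
    case (Cons a x b y)
    then obtain c d' where "d = c # d'"
      by (cases d) auto
    then show ?case
      using Cons by auto
  qed auto
qed

lemma lex_less_than_total:
  fixes x y :: "nat list"
  assumes "length x = length y" "x \<noteq> y"
  shows "(x, y) \<in> lex less_than \<or> (y, x) \<in> lex less_than"
  using assms by (induction x y rule: list_induct2) auto

lemma list_all2_le_imp_add:
  fixes x y :: "nat list"
  assumes "list_all2 (\<le>) y x"
  obtains d where "length d = length y" "x = map2 (+) y d"
proof
  show "length (map2 (-) x y) = length y"
    using assms by (simp add: list_all2_lengthD)
  show "x = map2 (+) y (map2 (-) x y)"
    using assms by (induction rule: list_all2_induct) auto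
qed

text \<open>The graded lexicographic monomial order. Degree comes first so that a minimal vector
  realizes the word length.\<close>

definition deglex :: "(nat list \<times> nat list) set" where
  "deglex = inv_image (less_than <*lex*> lex less_than) (\<lambda>x. (sum_list x, x))"

lemma deglex_iff:
  "(x, y) \<in> deglex \<longleftrightarrow> sum_list x < sum_list y \<or> sum_list x = sum_list y \<and> (x, y) \<in> lex less_than"
  by (auto simp: deglex_def)

lemma wf_deglex: "wf deglex"
  unfolding deglex_def by (intro wf_inv_image wf_lex_prod wf_lex wf_less_than)

text \<open>
  Every monoid element has exactly one deglex-minimal exponent vector, whose degree is the word
  length, and the minimal exponent vectors form a down-closed set.
\<close>

theorem word_growth_rational:
  fixes A :: "'a :: comm_semiring_1 set"
  assumes "finite A"
  obtains k h where "word_growth A * (1 - fps_X) ^ k = fps_of_poly h"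
proof -
  obtain as where as: "set as = A"
    using finite_list[OF assms] by blast
  define k where "k = length as"
  define val where "val = (\<lambda>x. nat_combination x as)"
  \<comment> \<open>Competitors are restricted to length \<open>k\<close> because
    \<open>deglex\<close> also relates vectors of other lengths, and \<open>zip\<close> would
    truncate them.\<close>
  define D where "D = {x. length x = k \<and> (\<forall>y. (y, x) \<in> deglex \<longrightarrow> length y = k \<longrightarrow> val y \<noteq> val x)}"
  have mem: "z \<in> sumset n A \<longleftrightarrow> (\<exists>x. length x = k \<and> sum_list x = n \<and> val x = z)" for z n
    using sumset_set_iff[of z n as] by (simp add: as k_def val_def)
  have down: "down_closed D"
    unfolding down_closed_def
  proof (intro ballI allI impI)
    fix x y assume x: "x \<in> D" and "list_all2 (\<le>) y x"
    then obtain d where d: "length d = length y" "x = map2 (+) y d"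
      by (auto elim: list_all2_le_imp_add)
    have len: "length y = k" "length d = k"
      using x d by (auto simp: D_def)
    have "val y' \<noteq> val y" if y': "(y', y) \<in> deglex" "length y' = k" for y'
    proof
      assume eq: "val y' = val y"
      \<comment> \<open>A smaller vector \<open>y'\<close> with the value of \<open>y\<close> would,
        after adding \<open>d\<close>, beat \<open>x\<close>.\<close>
      have "(map2 (+) y' d, x) \<in> deglex"
        using y' d len by (auto simp: deglex_iff sum_list_map2_add lex_map2_add)
      moreover have "val (map2 (+) y' d) = val x"
        using eq y' d len by (simp add: val_def nat_combination_add k_def)
      ultimately show False
        using x y' len by (auto simp: D_def)
    qed
    then show "y \<in> D"
      using len by (auto simp: D_def)
  qed
  have "bij_betw val {x \<in> D. sum_list x = n} (word_sphere A n)" for n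
    unfolding bij_betw_def
  proof (intro conjI equalityI subsetI)
    show "inj_on val {x \<in> D. sum_list x = n}"
    proof (rule inj_onI, rule ccontr)
      fix x y assume *: "x \<in> {x \<in> D. sum_list x = n}" "y \<in> {x \<in> D. sum_list x = n}"
        "val x = val y" "x \<noteq> y"
      then have "(x, y) \<in> deglex \<or> (y, x) \<in> deglex"
        using lex_less_than_total[of x y] by (auto simp: deglex_iff D_def)
      then show False
        using * by (auto simp: D_def)
    qed
  next
    fix z assume "z \<in> val ` {x \<in> D. sum_list x = n}"
    then obtain x where x: "x \<in> D" "sum_list x = n" "z = val x"
      by auto
    have "z \<in> sumset n A"
      using x by (auto simp: mem D_def)
    moreover have "z \<notin> sumset j A" if "j < n" for j
    proof
      assume "z \<in> sumset j A"
      then obtain y where "length y = k" "sum_list y = j" "val y = val x"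
        using x by (auto simp: mem)
      then show False
        using x that by (auto simp: D_def deglex_iff)
    qed
    ultimately show "z \<in> word_sphere A n"
      by (auto simp: word_sphere_def)
  next
    fix z assume z: "z \<in> word_sphere A n"
    define V where "V = {x. length x = k \<and> val x = z}"
    have "z \<in> sumset n A"
      using z word_sphere_subset_sumset by blast
    then obtain x0 where x0: "x0 \<in> V" "sum_list x0 = n"
      by (auto simp: mem V_def)
    obtain x where x: "x \<in> V" "\<And>y. (y, x) \<in> deglex \<Longrightarrow> y \<notin> V"
      using wfE_min[OF wf_deglex x0(1)] by metis
    have "z \<in> sumset (sum_list x) A"
      using x(1) by (auto simp: mem V_def)
    then have "n \<le> sum_list x"
      using z by (simp add: word_sphere_le)
    moreover have "sum_list x \<le> n"
      using x(2)[of x0] x0 by (metis deglex_iff linorder_not_less)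
    moreover have "x \<in> D"
      using x by (auto simp: D_def V_def)
    ultimately show "z \<in> val ` {x \<in> D. sum_list x = n}"
      using x(1) by (auto simp: V_def)
  qed
  then have "card {x \<in> D. sum_list x = n} = card (word_sphere A n)" for n
    by (rule bij_betw_same_card)
  then have "word_growth A = degree_series D"
    by (simp add: word_growth_def degree_series_def)
  moreover obtain h where "degree_series D * (1 - fps_X) ^ k = fps_of_poly h"
    using degree_series_down_closed[OF down, of k] by (auto simp: D_def)
  ultimately show ?thesis
    using that by metis
qed

section \<open>Order of the pole at 1\<close>

text \<open>Multiplying by \<open>1 - fps_X\<close> takes differences of coefficients, and Pascal's
  rule lowers \<open>L\<close>.\<close>

lemma choose_series:
  "Abs_fps (\<lambda>n. of_nat ((n + L) choose L)) * (1 - fps_X :: rat fps) ^ Suc L = 1"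
proof (induction L)
  case 0
  have "fps_nth (Abs_fps (\<lambda>n. 1) * (1 - fps_X)) n = fps_nth (1 :: rat fps) n" for n
    by (cases n) (simp_all add: right_diff_distrib)
  then show ?case
    by (simp add: fps_ext)
next
  case (Suc L)
  have "Abs_fps (\<lambda>n. of_nat ((n + Suc L) choose Suc L)) * (1 - fps_X) =
      Abs_fps (\<lambda>n. of_nat ((n + L) choose L) :: rat)"
  proof (rule fps_ext)
    show "fps_nth (Abs_fps (\<lambda>n. of_nat ((n + Suc L) choose Suc L)) * (1 - fps_X)) n =
        fps_nth (Abs_fps (\<lambda>n. of_nat ((n + L) choose L) :: rat)) n" for n
      by (cases n) (simp_all add: right_diff_distrib)
  qed
  then have "Abs_fps (\<lambda>n. of_nat ((n + Suc L) choose Suc L)) * (1 - fps_X) ^ Suc (Suc L) =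
      Abs_fps (\<lambda>n. of_nat ((n + L) choose L) :: rat) * (1 - fps_X) ^ Suc L"
    by (simp flip: mult.assoc)
  then show ?case
    by (simp only: Suc)
qed

text \<open>The shift by \<open>j\<close> comes from a numerator term of degree \<open>j\<close>;
  truncated subtraction affects only \<open>n < j\<close>.\<close>

lemma choose_asymptotics:
  "(\<lambda>n. real ((n - j + L) choose L) / real n ^ L) \<longlonglongrightarrow> 1 / fact L"
proof (induction L)
  case (Suc L)
  have "(\<lambda>n. (real n - real j + real L + 1) / real n) \<longlonglongrightarrow> 1"
    by real_asymp
  moreover have "\<forall>\<^sub>F n in sequentially. (real n - real j + real L + 1) / real n =
      real (n - j + Suc L) / real n"
    using eventually_ge_at_top[of j] by eventually_elim (simp add: of_nat_diff)
  ultimately have lim: "(\<lambda>n. real (n - j + Suc L) / real n) \<longlonglongrightarrow> 1"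
    by (rule Lim_transform_eventually)
  have eq: "real ((n - j + Suc L) choose Suc L) / real n ^ Suc L =
      real (n - j + Suc L) / real n * (real ((n - j + L) choose L) / real n ^ L) / real (Suc L)" for n
  proof -
    have "real (Suc L) * real ((n - j + Suc L) choose Suc L) =
        real (n - j + Suc L) * real ((n - j + L) choose L)"
      using Suc_times_binomial[of L "n - j + L"] by (metis add_Suc_right of_nat_mult)
    then have "real ((n - j + Suc L) choose Suc L) =
        real (n - j + Suc L) * real ((n - j + L) choose L) / real (Suc L)"
      by (simp add: field_simps del: of_nat_Suc)
    then show ?thesis
      by simp
  qed
  have "(\<lambda>n. real ((n - j + Suc L) choose Suc L) / real n ^ Suc L) \<longlonglongrightarrow>
      1 * (1 / fact L) / real (Suc L)"
    unfolding eq by (intro tendsto_intros lim Suc) simp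
  then show ?case
    by (simp add: mult.commute)
qed simp

text \<open>Every coefficient of \<open>h\<close> gets the same weight in the limit, so
  \<open>poly h 1\<close> decides whether the pole at 1 has full order.\<close>

lemma rational_series_asymptotics:
  fixes F :: "rat fps"
  assumes "F * (1 - fps_X) ^ Suc L = fps_of_poly h"
  shows "(\<lambda>n. real_of_rat (fps_nth F n) / real n ^ L) \<longlonglongrightarrow> real_of_rat (poly h 1) / fact L"
proof -
  define B where "B = (Abs_fps (\<lambda>n. of_nat ((n + L) choose L)) :: rat fps)"
  have "F = F * ((1 - fps_X) ^ Suc L * B)"
    using choose_series[of L] by (simp add: B_def mult.commute)
  also have "\<dots> = fps_of_poly h * B"
    by (simp flip: assms add: mult.assoc)
  finally have F: "F = fps_of_poly h * B" .
  have nth: "fps_nth F n = (\<Sum>j\<le>degree h. coeff h j * of_nat ((n - j + L) choose L))"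
    if "n \<ge> degree h" for n
  proof -
    have "fps_nth F n = (\<Sum>j=0..n. coeff h j * of_nat ((n - j + L) choose L))"
      unfolding F fps_mult_nth by (simp add: B_def)
    also have "\<dots> = (\<Sum>j\<le>degree h. coeff h j * of_nat ((n - j + L) choose L))"
      using that by (intro sum.mono_neutral_right) (auto intro: coeff_eq_0)
    finally show ?thesis .
  qed
  have "(\<lambda>n. \<Sum>j\<le>degree h. real_of_rat (coeff h j) * (real ((n - j + L) choose L) / real n ^ L))
      \<longlonglongrightarrow> (\<Sum>j\<le>degree h. real_of_rat (coeff h j) * (1 / fact L))"
    by (intro tendsto_intros choose_asymptotics)
  moreover have "\<forall>\<^sub>F n in sequentially.
      (\<Sum>j\<le>degree h. real_of_rat (coeff h j) * (real ((n - j + L) choose L) / real n ^ L)) =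
      real_of_rat (fps_nth F n) / real n ^ L"
    using eventually_ge_at_top[of "degree h"]
    by eventually_elim (simp add: nth of_rat_sum of_rat_mult sum_divide_distrib)
  ultimately have "(\<lambda>n. real_of_rat (fps_nth F n) / real n ^ L)
      \<longlonglongrightarrow> (\<Sum>j\<le>degree h. real_of_rat (coeff h j) * (1 / fact L))"
    by (rule Lim_transform_eventually)
  also have "(\<Sum>j\<le>degree h. real_of_rat (coeff h j) * (1 / fact L)) = real_of_rat (poly h 1) / fact L"
    by (simp add: poly_altdef of_rat_sum sum_divide_distrib)
  finally show ?thesis .
qed

text \<open>While the exponent exceeds \<open>d\<close>, the growth bound forces the leading
  asymptotic term to vanish. Then \<open>h\<close> has the root 1 and one factor
  \<open>1 - fps_X\<close> cancels.\<close>

lemma rational_series_pole_order: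
  fixes F :: "rat fps"
  assumes "F * (1 - fps_X) ^ K = fps_of_poly h"
    and bound: "\<And>n. \<bar>real_of_rat (\<Sum>k\<le>n. fps_nth F k)\<bar> \<le> C * real (n + 1) ^ d"
  shows "\<exists>h. F * (1 - fps_X) ^ d = fps_of_poly h"
  using assms(1)
proof (induction K arbitrary: h)
  case 0
  then have "F * (1 - fps_X) ^ d = fps_of_poly (h * (1 - monom 1 1) ^ d)"
    by (simp add: fps_of_poly_mult fps_of_poly_power fps_of_poly_diff fps_of_poly_monom)
  then show ?case
    by blast
next
  case (Suc K)
  show ?case
  proof (cases "Suc K \<le> d")
    case True
    then have "F * (1 - fps_X) ^ d = F * (1 - fps_X) ^ Suc K * (1 - fps_X) ^ (d - Suc K)"
      by (simp only: mult.assoc flip: power_add) simp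
    also have "\<dots> = fps_of_poly (h * (1 - monom 1 1) ^ (d - Suc K))"
      unfolding Suc.prems
      by (simp add: fps_of_poly_mult fps_of_poly_power fps_of_poly_diff fps_of_poly_monom)
    finally show ?thesis
      by blast
  next
    case False
    \<comment> \<open>Partial sums are the coefficients of \<open>F / (1 - fps_X)\<close>: same
      numerator, one more factor in the denominator.\<close>
    define G where "G = Abs_fps (\<lambda>n. \<Sum>k\<le>n. fps_nth F k)"
    have "G * (1 - fps_X) = F"
    proof (rule fps_ext)
      show "fps_nth (G * (1 - fps_X)) n = fps_nth F n" for n
        by (cases n) (simp_all add: G_def right_diff_distrib)
    qed
    then have "G * (1 - fps_X) ^ Suc (Suc K) = fps_of_poly h"
      using Suc.prems by (simp flip: mult.assoc)
    then have "(\<lambda>n. real_of_rat (fps_nth G n) / real n ^ Suc K) \<longlonglongrightarrow>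
        real_of_rat (poly h 1) / fact (Suc K)"
      by (rule rational_series_asymptotics)
    moreover have "(\<lambda>n. real_of_rat (fps_nth G n) / real n ^ Suc K) \<longlonglongrightarrow> 0"
    proof (rule tendsto_0_le)
      show "(\<lambda>n. \<bar>C\<bar> * 2 ^ d * (1 / real n)) \<longlonglongrightarrow> 0"
        by real_asymp
      show "\<forall>\<^sub>F n in sequentially. norm (real_of_rat (fps_nth G n) / real n ^ Suc K) \<le>
          norm (\<bar>C\<bar> * 2 ^ d * (1 / real n)) * 1"
        using eventually_gt_at_top[of 0]
      proof eventually_elim
        case (elim n)
        have "\<bar>real_of_rat (fps_nth G n)\<bar> \<le> C * real (n + 1) ^ d"
          using bound[of n] by (simp add: G_def)
        also have "\<dots> \<le> \<bar>C\<bar> * (2 * real n) ^ d"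
          using elim by (intro mult_mono power_mono) auto
        also have "\<dots> \<le> \<bar>C\<bar> * 2 ^ d * real n ^ K"
          using elim False by (simp add: power_mult_distrib mult_left_mono power_increasing mult_ac)
        finally have "\<bar>real_of_rat (fps_nth G n)\<bar> / real n ^ Suc K \<le>
            \<bar>C\<bar> * 2 ^ d * real n ^ K / real n ^ Suc K"
          by (rule divide_right_mono) simp
        then show ?case
          using elim by (simp add: abs_divide)
      qed
    qed
    ultimately have "real_of_rat (poly h 1) / fact (Suc K) = 0"
      by (rule LIMSEQ_unique)
    then have "poly h 1 = 0"
      by simp
    then obtain h' where h': "h = [:-1, 1:] * h'"
      by (metis dvdE poly_eq_0_iff_dvd)
    \<comment> \<open>The root factor is \<open>x - 1\<close>, whence the sign of \<open>h'\<close>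
      below.\<close>
    have "fps_of_poly [:-1, 1:] = (- (1 - fps_X) :: rat fps)"
      by (simp add: fps_of_poly_pCons)
    then have "(1 - fps_X) * (F * (1 - fps_X) ^ K) = (1 - fps_X) * fps_of_poly (- h')"
      using Suc.prems by (simp add: h' fps_of_poly_mult fps_of_poly_uminus mult_ac del: mult_pCons_left)
    moreover have "(1 - fps_X :: rat fps) \<noteq> 0"
      by (metis diff_0_right fps_X_nth fps_sub_nth fps_one_nth fps_zero_nth zero_neq_one)
    ultimately have "F * (1 - fps_X) ^ K = fps_of_poly (- h')"
      by (metis mult_left_cancel)
    then show ?thesis
      by (rule Suc.IH)
  qed
qed

section \<open>Coordinator polynomials\<close>

lemma ball_eq_UN_word_sphere: "(\<Union>k\<le>n. word_sphere A k) = (\<Union>k\<le>n. sumset k A)"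
proof (intro equalityI subsetI)
  fix z assume "z \<in> (\<Union>k\<le>n. sumset k A)"
  then obtain k where k: "k \<le> n" "z \<in> sumset k A"
    by auto
  define j where "j = (LEAST j. z \<in> sumset j A)"
  have "z \<in> sumset j A" "j \<le> k"
    unfolding j_def using k by (auto intro: LeastI Least_le)
  moreover have "z \<notin> sumset i A" if "i < j" for i
    using that unfolding j_def by (rule not_less_Least)
  ultimately have "z \<in> word_sphere A j" "j \<le> n"
    using k(1) by (auto simp: word_sphere_def)
  then show "z \<in> (\<Union>k\<le>n. word_sphere A k)"
    by blast
qed (auto simp: word_sphere_def)

lemma sum_word_growth:
  assumes "finite A"
  shows "(\<Sum>k\<le>n. fps_nth (word_growth A) k) = of_nat (card (\<Union>k\<le>n. sumset k A))"
proof -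
  have "card (\<Union>k\<le>n. word_sphere A k) = (\<Sum>k\<le>n. card (word_sphere A k))"
    using word_sphere_disjoint[of _ _ A] assms
    by (intro card_UN_disjoint) (auto simp: finite_word_sphere)
  then show ?thesis
    by (simp add: word_growth_def flip: ball_eq_UN_word_sphere)
qed

text \<open>In coordinates with respect to the first \<open>d\<close> powers of
  \<open>zeta m\<close>, the roots of unity are bounded by some \<open>B\<close>. A ball of radius
  \<open>n\<close> therefore lies in the image of a box of side
  \<open>2 * n * B + 1\<close>.\<close>

lemma card_unity_roots_ball_le:
  assumes "m > 0"
  obtains C where "\<And>n. real (card (\<Union>k\<le>n. sumset k (unity_roots m))) \<le> C * real (n + 1) ^ totient m"
proof -
  obtain g where g: "lead_coeff g = 1" "degree g > 0"
      "\<And>p. int_poly_eval p (zeta m) = 0 \<longleftrightarrow> g dvd p"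
    using unity_root_minimal_poly_exists[OF assms zeta_power_self] by metis
  define d where "d = degree g"
  have d: "d \<le> totient m"
    unfolding d_def using assms g(1,3) by (rule zeta_minimal_poly_degree_le)
  have "\<exists>r. zeta m ^ l = (\<Sum>i<d. of_int (r i) * zeta m ^ i)" for l
  proof -
    obtain q s where qs: "monom 1 l = g * q + s" "degree s < degree g"
      using monic_int_poly_division[OF g(1,2)] by blast
    have "zeta m ^ l = int_poly_eval (monom 1 l) (zeta m)"
      by simp
    also have "\<dots> = int_poly_eval s (zeta m)"
      using g(3)[of g] unfolding qs(1) by simp
    finally show ?thesis
      using int_poly_eval_eq_sum[of s d "zeta m"] qs(2) unfolding d_def by metis
  qed
  then obtain r where r: "\<And>l. zeta m ^ l = (\<Sum>i<d. of_int (r l i) * zeta m ^ i)"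
    by metis
  \<comment> \<open>Inserting 0 guarantees \<open>B \<ge> 0\<close>.\<close>
  define B where "B = Max (insert 0 ((\<lambda>(l, i). \<bar>r l i\<bar>) ` ({..<m} \<times> {..<d})))"
  have B: "\<bar>r l i\<bar> \<le> B" if "l < m" "i < d" for l i
    unfolding B_def using that by (intro Max_ge) auto
  have "B \<ge> 0"
    unfolding B_def by (intro Max_ge) auto
  define val where "val = (\<lambda>c. \<Sum>i<d. of_int (c i) * zeta m ^ i)"
  define box where "box = (\<lambda>n. {..<d} \<rightarrow>\<^sub>E {- (int n * B)..int n * B})"
  have sumset_box: "\<exists>c. (\<forall>i<d. \<bar>c i\<bar> \<le> int k * B) \<and> z = val c" if "z \<in> sumset k (unity_roots m)" for z k
    using that
  proof (induction k arbitrary: z)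
    case 0
    then show ?case
      by (intro exI[of _ "\<lambda>_. 0"]) (simp add: val_def)
  next
    case (Suc k)
    then obtain l w where lw: "z = zeta m ^ l + w" "l < m" "w \<in> sumset k (unity_roots m)"
      by (auto simp: sumset_Suc unity_roots_eq_image[OF assms])
    from Suc.IH[OF lw(3)] obtain c where c: "\<And>i. i < d \<Longrightarrow> \<bar>c i\<bar> \<le> int k * B" "w = val c"
      by blast
    have "\<bar>r l i + c i\<bar> \<le> int (Suc k) * B" if "i < d" for i
      using B[OF lw(2) that] c(1)[OF that] by (simp add: algebra_simps)
    moreover have "z = val (\<lambda>i. r l i + c i)"
      by (simp add: lw(1) c(2) r[of l] val_def sum.distrib algebra_simps)
    ultimately show ?case
      by (intro exI[of _ "\<lambda>i. r l i + c i"] conjI allI impI)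
  qed
  have "real (card (\<Union>k\<le>n. sumset k (unity_roots m))) \<le>
      real_of_int (2 * B + 1) ^ d * real (n + 1) ^ totient m" for n
  proof -
    have "(\<Union>k\<le>n. sumset k (unity_roots m)) \<subseteq> val ` box n"
    proof
      fix z assume "z \<in> (\<Union>k\<le>n. sumset k (unity_roots m))"
      then obtain k c where k: "k \<le> n" "\<And>i. i < d \<Longrightarrow> \<bar>c i\<bar> \<le> int k * B" "z = val c"
        using sumset_box by blast
      have "int k * B \<le> int n * B"
        using k(1) \<open>B \<ge> 0\<close> by (intro mult_right_mono) auto
      then have "\<bar>c i\<bar> \<le> int n * B" if "i < d" for i
        using k(2)[OF that] by simp
      then have "restrict c {..<d} \<in> box n"
        by (fastforce simp: box_def abs_le_iff)
      moreover have "z = val (restrict c {..<d})"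
        by (simp add: k(3) val_def)
      ultimately show "z \<in> val ` box n"
        by blast
    qed
    then have "card (\<Union>k\<le>n. sumset k (unity_roots m)) \<le> card (box n)"
      by (rule surj_card_le[rotated]) (auto simp: box_def intro: finite_PiE)
    also have "\<dots> = nat (2 * (int n * B) + 1) ^ d"
      by (simp add: box_def card_PiE mult.commute[of B])
    finally have "real (card (\<Union>k\<le>n. sumset k (unity_roots m))) \<le>
        real (nat (2 * (int n * B) + 1) ^ d)"
      by (rule of_nat_mono)
    also have "\<dots> = real_of_int (2 * (int n * B) + 1) ^ d"
      using \<open>B \<ge> 0\<close> by simp
    also have "\<dots> \<le> (real_of_int (2 * B + 1) * real (n + 1)) ^ d"
      using \<open>B \<ge> 0\<close> by (intro power_mono) (simp_all add: algebra_simps)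
    also have "\<dots> = real_of_int (2 * B + 1) ^ d * real (n + 1) ^ d"
      by (rule power_mult_distrib)
    also have "\<dots> \<le> real_of_int (2 * B + 1) ^ d * real (n + 1) ^ totient m"
      using d \<open>B \<ge> 0\<close> by (intro mult_left_mono power_increasing) auto
    finally show ?thesis .
  qed
  then show ?thesis
    by (rule that)
qed

text \<open>The denominator has constant term 1, hence is a unit and the division is exact.\<close>

lemma is_coordinator_poly_iff:
  "is_coordinator_poly m h \<longleftrightarrow> growth_series m * (1 - fps_X) ^ totient m = fps_of_poly h"
proof -
  have unit: "is_unit ((1 - fps_X :: rat fps) ^ totient m)"
    by (simp add: fps_nth_power_0)
  show ?thesis
    unfolding is_coordinator_poly_def using unit
    by (metis dvd_div_mult_self nonzero_mult_div_cancel_right not_is_unit_0 unit_imp_dvd)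
qed

theorem coordinator_poly_exists:
  assumes "m > 0"
  shows "\<exists>h. is_coordinator_poly m h"
proof -
  have fin: "finite (unity_roots m)"
    using assms by (rule finite_unity_roots)
  obtain k h where h: "word_growth (unity_roots m) * (1 - fps_X) ^ k = fps_of_poly h"
    using fin by (rule word_growth_rational)
  obtain C where "\<And>n. real (card (\<Union>k\<le>n. sumset k (unity_roots m))) \<le> C * real (n + 1) ^ totient m"
    using assms by (rule card_unity_roots_ball_le) blast
  then have "\<bar>real_of_rat (\<Sum>k\<le>n. fps_nth (word_growth (unity_roots m)) k)\<bar> \<le>
      C * real (n + 1) ^ totient m" for n
    unfolding sum_word_growth[OF fin] by simp
  from rational_series_pole_order[OF h this] show ?thesis
    by (simp add: is_coordinator_poly_iff growth_series_eq_word_growth[OF assms])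
qed

lemma coordinator_poly_eqI: "is_coordinator_poly m h \<Longrightarrow> coordinator_poly m = h"
  unfolding coordinator_poly_def by (blast intro: is_coordinator_poly_unique)

section \<open>Radical, totient and the power formula\<close>

lemma nat_radical_dvd:
  assumes "m > 0"
  shows "nat_radical m dvd m"
proof -
  have "nat_radical m dvd (\<Prod>p\<in>prime_factors m. p ^ multiplicity p m)"
    unfolding nat_radical_def
    by (intro prod_dvd_prod dvd_power) (auto simp: prime_factors_multiplicity)
  also have "\<dots> = m"
    using assms by (simp add: prod_prime_factors)
  finally show ?thesis .
qed

lemma prime_dvd_nat_radical:
  assumes "prime p" "p dvd m" "m > 0"
  shows "p dvd nat_radical m"
  unfolding nat_radical_def using assms by (intro dvd_prodI) (auto simp: prime_factors_dvd)

text \<open>In Euler's product formula the product over primes is the same for \<open>q * r\<close>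
  and \<open>r\<close>.\<close>

lemma totient_mult_same_primes:
  assumes "q > 0" "r > 0" "\<And>p. prime p \<Longrightarrow> p dvd q \<Longrightarrow> p dvd r"
  shows "totient (q * r) = q * totient r"
proof -
  have "prime_factors (q * r) = prime_factors r"
    using assms by (auto simp: prime_factors_dvd prime_dvd_mult_iff)
  then have "real (totient (q * r)) = real (q * totient r)"
    by (simp add: totient_formula2)
  then show ?thesis
    by (simp only: of_nat_eq_iff)
qed

theorem theorem1p5:
  fixes m :: nat
  assumes "m > 0"
  shows "coordinator_poly m = coordinator_poly (nat_radical m) ^ (m div nat_radical m)"
proof -
  define r where "r = nat_radical m"
  define q where "q = m div r"
  have m: "m = q * r"
    using nat_radical_dvd[OF assms] by (simp add: q_def r_def)
  have pos: "q > 0" "r > 0"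
    using assms m by auto
  have primes: "p dvd r" if "prime p" "p dvd q" for p
    unfolding r_def using that assms by (intro prime_dvd_nat_radical) (simp_all add: m)
  \<comment> \<open>Existence is invoked for \<open>r\<close> only; \<open>h ^ q\<close> is then
    verified to be a coordinator polynomial for \<open>m\<close>, and uniqueness evaluates both
    descriptions.\<close>
  obtain h where h: "is_coordinator_poly r h"
    using coordinator_poly_exists[OF pos(2)] by blast
  have "growth_series m = growth_series r ^ q"
    unfolding m using pos primes by (rule growth_series_mult)
  moreover have "totient m = totient r * q"
    unfolding m mult.commute[of "totient r"] using pos primes by (rule totient_mult_same_primes)
  ultimately have "growth_series m * (1 - fps_X) ^ totient m =
      (growth_series r * (1 - fps_X) ^ totient r) ^ q"
    by (simp add: power_mult_distrib power_mult)
  then have "is_coordinator_poly m (h ^ q)"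
    using h by (simp add: is_coordinator_poly_iff fps_of_poly_power)
  then show ?thesis
    using h by (simp add: coordinator_poly_eqI flip: q_def r_def)
qed

end
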